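(* Let $(A,[\cdot,\cdot],\rho)$ be a complex Lie algebroid over $M$ with constant real rank. Write $\rho=\rho_1+i\rho_2$, where $\rho_1,\rho_2:A\to TM$ are real-linear bundle maps, let $A^{\mathrm{re}}=\ker\rho_2$, let $j_A:A\to A$ be multiplication by $i$ in the fibers, and put $\rho^{\mathrm{re}}=\rho_1|_{A^{\mathrm{re}}}$ and $\rho^{\mathrm{im}}=-\rho_2|_{j_A(A^{\mathrm{re}})}$. Then $$\bigl(A^{\mathrm{re}},\,[\cdot,\cdot]|_{A^{\mathrm{re}}},\,\rho^{\mathrm{re}}\bigr)\quad\text{and}\quad \bigl(j_A(A^{\mathrm{re}}),\,j_A[\cdot,\cdot]|_{j_A(A^{\mathrm{re}})},\,\rho^{\mathrm{im}}\bigr)$$ are isomorphic real Lie algebroids, with the isomorphism given by the restriction of $j_A$. Moreover, $\rho^{\mathrm{re}}(A^{\mathrm{re}})=\rho^{\mathrm{im}}(j_A(A^{\mathrm{re}}))=\Delta$, where $\Delta=\rho(A)\cap\overline{\rho(A)}\cap TM$ is the real part of $\rho(A)\cap\overline{\rho(A)}$.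
   Context: A complex Lie algebroid over a smooth real manifold $M$ is a complex vector bundle $A\to M$ with a $\mathbb{C}$-bilinear Lie bracket on $\Gamma(A)$ (satisfying the Jacobi identity) and a $\mathbb{C}$-linear bundle map $\rho:A\to T_{\mathbb{C}}M=TM\otimes\mathbb{C}$ (the anchor) preserving brackets and satisfying $[\alpha,f\beta]=f[\alpha,\beta]+(\rho(\alpha)f)\beta$ for all $\alpha,\beta\in\Gamma(A)$ and $f\in C^\infty(M,\mathbb{C})$. A real Lie algebroid is the usual notion (real vector bundle, real anchor to $TM$, Lie bracket on sections satisfying the Leibniz rule for $f\in C^\infty(M)$). The real rank of $A$ is the function $m\mapsto\dim_{\mathbb{R}}A^{\mathrm{re}}|_m$; when it is constant, $A^{\mathrm{re}}$ is a real vector subbundle of $A$ regarded as a real vector bundle. Here $j_A[\cdot,\cdot]$ denotes the bracket $(x,y)\mapsto i[x,y]$, and the bar denotes complex conjugation in $T_{\mathbb{C}}M$. *)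

theory Defs
  imports "HOL-Analysis.Analysis" "HOL-Library.Function_Algebras"
begin

section \<open>Smooth manifolds\<close>

primrec Ck_on :: "nat \<Rightarrow> 'a::real_normed_vector set \<Rightarrow> ('a \<Rightarrow> 'b::real_normed_vector) \<Rightarrow> bool" where
  "Ck_on 0 S f \<longleftrightarrow> continuous_on S f"
| "Ck_on (Suc k) S f \<longleftrightarrow> (\<forall>x\<in>S. f differentiable (at x)) \<and>
     (\<forall>v. Ck_on k S (\<lambda>x. frechet_derivative f (at x) v))"

text \<open>Only used for open sets; the spaces are finite-dimensional, so smoothness of all
  directional derivatives is smoothness of the derivative.\<close>

definition smooth_on :: "'a::real_normed_vector set \<Rightarrow> ('a \<Rightarrow> 'b::real_normed_vector) \<Rightarrow> bool" where
  "smooth_on S f \<longleftrightarrow> (\<forall>k. Ck_on k S f)"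

text \<open>The manifold \<open>M\<close> is the whole of the type \<open>'m\<close>. A chart is a pair of its domain and its
  coordinate map. The model space \<open>'e\<close> is a finite-dimensional inner product space, i.e. some
  Euclidean space; the class \<open>euclidean_space\<close> is not used because it excludes dimension 0.\<close>

type_synonym ('m, 'e) chart = "'m set \<times> ('m \<Rightarrow> 'e)"

definition cinv :: "('m, 'e) chart \<Rightarrow> 'e \<Rightarrow> 'm" where
  "cinv c = inv_into (fst c) (snd c)"

definition smooth_manifold ::
    "('m::{t2_space,second_countable_topology}, 'e::real_inner) chart set \<Rightarrow> bool" where
  "smooth_manifold \<A> \<longleftrightarrow>
     (\<exists>B::'e set. finite B \<and> span B = UNIV) \<and>
     (\<Union>c\<in>\<A>. fst c) = UNIV \<and>
     (\<forall>c\<in>\<A>. open (fst c) \<and> open (snd c ` fst c) \<and>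
        homeomorphism (fst c) (snd c ` fst c) (snd c) (cinv c)) \<and>
     (\<forall>c\<in>\<A>. \<forall>c'\<in>\<A>. smooth_on (snd c ` (fst c \<inter> fst c')) (snd c' \<circ> cinv c))"

text \<open>Smoothness of a map on an open subset \<open>W\<close> of the manifold.\<close>

definition smooth_fun ::
    "('m, 'e::real_inner) chart set \<Rightarrow> 'm set \<Rightarrow> ('m \<Rightarrow> 'b::real_normed_vector) \<Rightarrow> bool" where
  "smooth_fun \<A> W f \<longleftrightarrow> (\<forall>c\<in>\<A>. smooth_on (snd c ` (fst c \<inter> W)) (f \<circ> cinv c))"


section \<open>Tangent vectors and vector fields\<close>

text \<open>A tangent vector at \<open>p\<close> is an equivalence class of pairs of a chart around \<open>p\<close> and a vector
  of the model space, two pairs being equivalent if the derivative of the change of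
  coordinates maps one vector to the other. The class is encoded as the function that
  sends each chart around \<open>p\<close> to the representing vector, and everything else to 0. The addition
  of tangent vectors is the pointwise one of \<open>Function_Algebras\<close>.\<close>

type_synonym ('m, 'e) tvec = "('m, 'e) chart \<Rightarrow> 'e"

definition tangent_space ::
    "('m, 'e::real_inner) chart set \<Rightarrow> 'm \<Rightarrow> ('m, 'e) tvec set" where
  "tangent_space \<A> p = {v.
     (\<forall>c\<in>\<A>. \<forall>c'\<in>\<A>. p \<in> fst c \<longrightarrow> p \<in> fst c' \<longrightarrow>
        v c' = frechet_derivative (snd c' \<circ> cinv c) (at (snd c p)) (v c)) \<and>
     (\<forall>c. c \<notin> \<A> \<or> p \<notin> fst c \<longrightarrow> v c = 0)}"

definition tscale :: "real \<Rightarrow> ('m, 'e::real_inner) tvec \<Rightarrow> ('m, 'e) tvec" where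
  "tscale r v = (\<lambda>c. r *\<^sub>R v c)"

text \<open>The derivative of a function along a tangent vector at \<open>p\<close>. For smooth functions it does
  not depend on the choice of the chart.\<close>

definition tderiv ::
    "('m, 'e::real_inner) chart set \<Rightarrow> 'm \<Rightarrow> ('m, 'e) tvec \<Rightarrow> ('m \<Rightarrow> 'b::real_normed_vector) \<Rightarrow> 'b" where
  "tderiv \<A> p v f = (let c = (SOME c. c \<in> \<A> \<and> p \<in> fst c) in
     frechet_derivative (f \<circ> cinv c) (at (snd c p)) (v c))"

text \<open>The Lie bracket, given in each chart by \<open>D Y (X) - D X (Y)\<close>, so that
  \<open>[X, Y] f = X (Y f) - Y (X f)\<close>.\<close>

definition vf_bracket ::
    "('m, 'e::real_inner) chart set \<Rightarrow> ('m \<Rightarrow> ('m, 'e) tvec) \<Rightarrow> ('m \<Rightarrow> ('m, 'e) tvec)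
      \<Rightarrow> 'm \<Rightarrow> ('m, 'e) tvec" where
  "vf_bracket \<A> X Y = (\<lambda>p c. if c \<in> \<A> \<and> p \<in> fst c
     then frechet_derivative ((\<lambda>q. Y q c) \<circ> cinv c) (at (snd c p)) (X p c)
        - frechet_derivative ((\<lambda>q. X q c) \<circ> cinv c) (at (snd c p)) (Y p c)
     else 0)"

text \<open>The pair \<open>(v, w)\<close> stands for the complexified tangent vector \<open>v + \<i> w\<close>.\<close>

type_synonym ('m, 'e) ctvec = "('m, 'e) tvec \<times> ('m, 'e) tvec"

definition ctangent_space ::
    "('m, 'e::real_inner) chart set \<Rightarrow> 'm \<Rightarrow> ('m, 'e) ctvec set" where
  "ctangent_space \<A> p = tangent_space \<A> p \<times> tangent_space \<A> p"

definition ctscale :: "complex \<Rightarrow> ('m, 'e::real_inner) ctvec \<Rightarrow> ('m, 'e) ctvec" where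
  "ctscale z u = (tscale (Re z) (fst u) - tscale (Im z) (snd u),
                  tscale (Re z) (snd u) + tscale (Im z) (fst u))"

definition conj_ctvec :: "('m, 'e::real_inner) ctvec \<Rightarrow> ('m, 'e) ctvec" where
  "conj_ctvec u = (fst u, - snd u)"

definition of_tvec :: "('m, 'e::real_inner) tvec \<Rightarrow> ('m, 'e) ctvec" where
  "of_tvec v = (v, 0)"

definition ctderiv ::
    "('m, 'e::real_inner) chart set \<Rightarrow> 'm \<Rightarrow> ('m, 'e) ctvec \<Rightarrow> ('m \<Rightarrow> complex) \<Rightarrow> complex" where
  "ctderiv \<A> p u f = tderiv \<A> p (fst u) f + \<i> * tderiv \<A> p (snd u) f"

text \<open>The complex bilinear extension of \<open>vf_bracket\<close>.\<close>

definition cvf_bracket ::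
    "('m, 'e::real_inner) chart set \<Rightarrow> ('m \<Rightarrow> ('m, 'e) ctvec) \<Rightarrow> ('m \<Rightarrow> ('m, 'e) ctvec)
      \<Rightarrow> 'm \<Rightarrow> ('m, 'e) ctvec" where
  "cvf_bracket \<A> X Y = (\<lambda>p.
     (vf_bracket \<A> (fst \<circ> X) (fst \<circ> Y) p - vf_bracket \<A> (snd \<circ> X) (snd \<circ> Y) p,
      vf_bracket \<A> (fst \<circ> X) (snd \<circ> Y) p + vf_bracket \<A> (snd \<circ> X) (fst \<circ> Y) p))"


section \<open>Vector bundles\<close>

text \<open>A vector bundle over \<open>'m\<close> with scalars \<open>'k\<close>, which is \<open>real\<close> or \<open>complex\<close>. The fibers are
  subspaces of a vector space \<open>('v, +, scale)\<close> that serves only as a reservoir of points and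
  linear operations; the smooth structure is entirely given by the local trivializations. A local
  trivialization \<open>(U, \<tau>)\<close> consists of linear isomorphisms \<open>\<tau> m\<close> from the fiber at \<open>m \<in> U\<close>
  onto \<open>coord_space r\<close>, which is \<open>'k\<close> to the power \<open>r\<close>.\<close>

record ('m, 'v, 'k) vbundle =
  fiber :: "'m \<Rightarrow> 'v set"
  bundle_rank :: nat
  scale :: "'k \<Rightarrow> 'v \<Rightarrow> 'v"
  trivs :: "('m set \<times> ('m \<Rightarrow> 'v \<Rightarrow> nat \<Rightarrow> 'k)) set"

definition coord_space :: "nat \<Rightarrow> (nat \<Rightarrow> 'k::zero) set" where
  "coord_space r = {x. \<forall>i\<ge>r. x i = 0}"

definition fiberwise_iso ::
    "('k::real_normed_field \<Rightarrow> 'v::ab_group_add \<Rightarrow> 'v) \<Rightarrow> 'v set \<Rightarrow> nat \<Rightarrow> ('v \<Rightarrow> nat \<Rightarrow> 'k) \<Rightarrow> bool" where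
  "fiberwise_iso sc F r t \<longleftrightarrow> bij_betw t F (coord_space r) \<and>
     (\<forall>a\<in>F. \<forall>b\<in>F. \<forall>i. t (a + b) i = t a i + t b i) \<and>
     (\<forall>z. \<forall>a\<in>F. \<forall>i. t (sc z a) i = z * t a i)"

definition vector_bundle ::
    "('m::topological_space, 'e::real_inner) chart set \<Rightarrow>
     ('m, 'v::ab_group_add, 'k::real_normed_field) vbundle \<Rightarrow> bool" where
  "vector_bundle \<A> E \<longleftrightarrow>
     vector_space (scale E) \<and>
     (\<forall>m. module.subspace (scale E) (fiber E m)) \<and>
     (\<Union>(U, \<tau>)\<in>trivs E. U) = UNIV \<and>
     (\<forall>(U, \<tau>)\<in>trivs E. open U \<and> (\<forall>m\<in>U. fiberwise_iso (scale E) (fiber E m) (bundle_rank E) (\<tau> m))) \<and>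
     (\<forall>(U, \<tau>)\<in>trivs E. \<forall>(V, \<sigma>)\<in>trivs E. \<forall>x\<in>coord_space (bundle_rank E). \<forall>i<bundle_rank E.
        smooth_fun \<A> (U \<inter> V) (\<lambda>m. \<sigma> m (inv_into (fiber E m) (\<tau> m) x) i))"

text \<open>Smooth sections over an open set \<open>W\<close>.\<close>

definition sections ::
    "('m, 'e::real_inner) chart set \<Rightarrow> ('m, 'v, 'k::real_normed_field) vbundle \<Rightarrow>
     'm set \<Rightarrow> ('m \<Rightarrow> 'v) set" where
  "sections \<A> E W = {s. (\<forall>m\<in>W. s m \<in> fiber E m) \<and>
     (\<forall>(U, \<tau>)\<in>trivs E. \<forall>i<bundle_rank E. smooth_fun \<A> (W \<inter> U) (\<lambda>m. \<tau> m (s m) i))}"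

text \<open>Smooth bundle maps over the identity of \<open>M\<close>.\<close>

definition bundle_map ::
    "('m, 'e::real_inner) chart set \<Rightarrow> ('m, 'v::ab_group_add, 'k::real_normed_field) vbundle \<Rightarrow>
     ('m, 'w::ab_group_add, 'k) vbundle \<Rightarrow> ('m \<Rightarrow> 'v \<Rightarrow> 'w) \<Rightarrow> bool" where
  "bundle_map \<A> E E' \<Phi> \<longleftrightarrow>
     (\<forall>m. \<forall>a\<in>fiber E m. \<Phi> m a \<in> fiber E' m \<and>
        (\<forall>b\<in>fiber E m. \<Phi> m (a + b) = \<Phi> m a + \<Phi> m b) \<and>
        (\<forall>z. \<Phi> m (scale E z a) = scale E' z (\<Phi> m a))) \<and>
     (\<forall>(U, \<tau>)\<in>trivs E. \<forall>(V, \<sigma>)\<in>trivs E'. \<forall>x\<in>coord_space (bundle_rank E). \<forall>i<bundle_rank E'.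
        smooth_fun \<A> (U \<inter> V) (\<lambda>m. \<sigma> m (\<Phi> m (inv_into (fiber E m) (\<tau> m) x)) i))"

definition bundle_iso ::
    "('m, 'e::real_inner) chart set \<Rightarrow> ('m, 'v::ab_group_add, 'k::real_normed_field) vbundle \<Rightarrow>
     ('m, 'w::ab_group_add, 'k) vbundle \<Rightarrow> ('m \<Rightarrow> 'v \<Rightarrow> 'w) \<Rightarrow> bool" where
  "bundle_iso \<A> E E' \<Phi> \<longleftrightarrow> bundle_map \<A> E E' \<Phi> \<and>
     (\<forall>m. bij_betw (\<Phi> m) (fiber E m) (fiber E' m)) \<and>
     bundle_map \<A> E' E (\<lambda>m. inv_into (fiber E m) (\<Phi> m))"

text \<open>A family \<open>S\<close> of \<open>k\<close>-dimensional real subspaces of the fibers of a complex vector bundle \<open>E\<close>,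
  with the structure induced from \<open>E\<close> regarded as a real bundle: its local
  trivializations are those whose associated local frames are smooth as local sections of \<open>E\<close>
  (the real and imaginary parts of the complex coordinates are the real coordinates, so smooth
  sections of \<open>E\<close> are the same for both structures). Then \<open>S\<close> is a real vector subbundle of \<open>E\<close>
  iff this structure is a vector bundle, i.e. such trivializations exist around each point.\<close>

definition real_scale :: "('m, 'v, complex) vbundle \<Rightarrow> real \<Rightarrow> 'v \<Rightarrow> 'v" where
  "real_scale E r = scale E (complex_of_real r)"

definition real_subbundle ::
    "('m::topological_space, 'e::real_inner) chart set \<Rightarrow>
     ('m, 'v::ab_group_add, complex) vbundle \<Rightarrow> ('m \<Rightarrow> 'v set) \<Rightarrow> nat \<Rightarrow> ('m, 'v, real) vbundle" where
  "real_subbundle \<A> E S k = \<lparr> fiber = S, bundle_rank = k, scale = real_scale E,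
     trivs = {(U, \<tau>). open U \<and> (\<forall>m\<in>U. fiberwise_iso (real_scale E) (S m) k (\<tau> m)) \<and>
       (\<forall>x\<in>coord_space k. (\<lambda>m. inv_into (S m) (\<tau> m) x) \<in> sections \<A> E U)} \<rparr>"


section \<open>Lie algebroids\<close>

definition lie_bracket_on_sections ::
    "('m, 'e::real_inner) chart set \<Rightarrow> ('m, 'v::ab_group_add, 'k::real_normed_field) vbundle \<Rightarrow>
     (('m \<Rightarrow> 'v) \<Rightarrow> ('m \<Rightarrow> 'v) \<Rightarrow> 'm \<Rightarrow> 'v) \<Rightarrow> bool" where
  "lie_bracket_on_sections \<A> E br \<longleftrightarrow> (let \<Gamma> = sections \<A> E UNIV in
     (\<forall>\<alpha>\<in>\<Gamma>. \<forall>\<beta>\<in>\<Gamma>. br \<alpha> \<beta> \<in> \<Gamma>) \<and>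
     (\<forall>\<alpha>\<in>\<Gamma>. \<forall>\<beta>\<in>\<Gamma>. \<forall>\<gamma>\<in>\<Gamma>. br (\<alpha> + \<beta>) \<gamma> = br \<alpha> \<gamma> + br \<beta> \<gamma> \<and> br \<gamma> (\<alpha> + \<beta>) = br \<gamma> \<alpha> + br \<gamma> \<beta>) \<and>
     (\<forall>\<alpha>\<in>\<Gamma>. \<forall>\<beta>\<in>\<Gamma>. \<forall>z. br (\<lambda>m. scale E z (\<alpha> m)) \<beta> = (\<lambda>m. scale E z (br \<alpha> \<beta> m)) \<and>
                         br \<alpha> (\<lambda>m. scale E z (\<beta> m)) = (\<lambda>m. scale E z (br \<alpha> \<beta> m))) \<and>
     (\<forall>\<alpha>\<in>\<Gamma>. br \<alpha> \<alpha> = 0) \<and>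
     (\<forall>\<alpha>\<in>\<Gamma>. \<forall>\<beta>\<in>\<Gamma>. \<forall>\<gamma>\<in>\<Gamma>. br \<alpha> (br \<beta> \<gamma>) + br \<beta> (br \<gamma> \<alpha>) + br \<gamma> (br \<alpha> \<beta>) = 0))"

text \<open>Smoothness of the anchor is expressed in the local trivializations of the bundle and in
  those of the (complexified) tangent bundle that are given by the charts.\<close>

definition real_lie_algebroid ::
    "('m::topological_space, 'e::real_inner) chart set \<Rightarrow>
     ('m, 'v::ab_group_add, real) vbundle \<Rightarrow>
     (('m \<Rightarrow> 'v) \<Rightarrow> ('m \<Rightarrow> 'v) \<Rightarrow> 'm \<Rightarrow> 'v) \<Rightarrow> ('m \<Rightarrow> 'v \<Rightarrow> ('m, 'e) tvec) \<Rightarrow> bool" where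
  "real_lie_algebroid \<A> A br \<rho> \<longleftrightarrow>
     vector_bundle \<A> A \<and>
     lie_bracket_on_sections \<A> A br \<and>
     (\<forall>m. \<forall>a\<in>fiber A m. \<rho> m a \<in> tangent_space \<A> m \<and>
        (\<forall>b\<in>fiber A m. \<rho> m (a + b) = \<rho> m a + \<rho> m b) \<and>
        (\<forall>r. \<rho> m (scale A r a) = tscale r (\<rho> m a))) \<and>
     (\<forall>(U, \<tau>)\<in>trivs A. \<forall>c\<in>\<A>. \<forall>x\<in>coord_space (bundle_rank A).
        smooth_fun \<A> (U \<inter> fst c) (\<lambda>m. \<rho> m (inv_into (fiber A m) (\<tau> m) x) c)) \<and>
     (\<forall>\<alpha>\<in>sections \<A> A UNIV. \<forall>\<beta>\<in>sections \<A> A UNIV.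
        (\<lambda>m. \<rho> m (br \<alpha> \<beta> m)) = vf_bracket \<A> (\<lambda>m. \<rho> m (\<alpha> m)) (\<lambda>m. \<rho> m (\<beta> m))) \<and>
     (\<forall>\<alpha>\<in>sections \<A> A UNIV. \<forall>\<beta>\<in>sections \<A> A UNIV. \<forall>f::'m \<Rightarrow> real. smooth_fun \<A> UNIV f \<longrightarrow>
        br \<alpha> (\<lambda>m. scale A (f m) (\<beta> m)) =
        (\<lambda>m. scale A (f m) (br \<alpha> \<beta> m) + scale A (tderiv \<A> m (\<rho> m (\<alpha> m)) f) (\<beta> m)))"

definition complex_lie_algebroid ::
    "('m::topological_space, 'e::real_inner) chart set \<Rightarrow>
     ('m, 'v::ab_group_add, complex) vbundle \<Rightarrow>
     (('m \<Rightarrow> 'v) \<Rightarrow> ('m \<Rightarrow> 'v) \<Rightarrow> 'm \<Rightarrow> 'v) \<Rightarrow> ('m \<Rightarrow> 'v \<Rightarrow> ('m, 'e) ctvec) \<Rightarrow> bool" where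
  "complex_lie_algebroid \<A> A br \<rho> \<longleftrightarrow>
     vector_bundle \<A> A \<and>
     lie_bracket_on_sections \<A> A br \<and>
     (\<forall>m. \<forall>a\<in>fiber A m. \<rho> m a \<in> ctangent_space \<A> m \<and>
        (\<forall>b\<in>fiber A m. \<rho> m (a + b) = \<rho> m a + \<rho> m b) \<and>
        (\<forall>z. \<rho> m (scale A z a) = ctscale z (\<rho> m a))) \<and>
     (\<forall>(U, \<tau>)\<in>trivs A. \<forall>c\<in>\<A>. \<forall>x\<in>coord_space (bundle_rank A).
        smooth_fun \<A> (U \<inter> fst c) (\<lambda>m. fst (\<rho> m (inv_into (fiber A m) (\<tau> m) x)) c) \<and>
        smooth_fun \<A> (U \<inter> fst c) (\<lambda>m. snd (\<rho> m (inv_into (fiber A m) (\<tau> m) x)) c)) \<and>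
     (\<forall>\<alpha>\<in>sections \<A> A UNIV. \<forall>\<beta>\<in>sections \<A> A UNIV.
        (\<lambda>m. \<rho> m (br \<alpha> \<beta> m)) = cvf_bracket \<A> (\<lambda>m. \<rho> m (\<alpha> m)) (\<lambda>m. \<rho> m (\<beta> m))) \<and>
     (\<forall>\<alpha>\<in>sections \<A> A UNIV. \<forall>\<beta>\<in>sections \<A> A UNIV. \<forall>f::'m \<Rightarrow> complex. smooth_fun \<A> UNIV f \<longrightarrow>
        br \<alpha> (\<lambda>m. scale A (f m) (\<beta> m)) =
        (\<lambda>m. scale A (f m) (br \<alpha> \<beta> m) + scale A (ctderiv \<A> m (\<rho> m (\<alpha> m)) f) (\<beta> m)))"

text \<open>\<open>\<Phi>\<close> is an isomorphism from \<open>(A, br, \<rho>)\<close> to \<open>(A', br', \<rho>')\<close>.\<close>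

definition real_lie_algebroid_iso ::
    "('m, 'e::real_inner) chart set \<Rightarrow>
     ('m, 'v::ab_group_add, real) vbundle \<Rightarrow>
     (('m \<Rightarrow> 'v) \<Rightarrow> ('m \<Rightarrow> 'v) \<Rightarrow> 'm \<Rightarrow> 'v) \<Rightarrow> ('m \<Rightarrow> 'v \<Rightarrow> ('m, 'e) tvec) \<Rightarrow>
     ('m, 'w::ab_group_add, real) vbundle \<Rightarrow>
     (('m \<Rightarrow> 'w) \<Rightarrow> ('m \<Rightarrow> 'w) \<Rightarrow> 'm \<Rightarrow> 'w) \<Rightarrow> ('m \<Rightarrow> 'w \<Rightarrow> ('m, 'e) tvec) \<Rightarrow>
     ('m \<Rightarrow> 'v \<Rightarrow> 'w) \<Rightarrow> bool" where
  "real_lie_algebroid_iso \<A> A br \<rho> A' br' \<rho>' \<Phi> \<longleftrightarrow>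
     bundle_iso \<A> A A' \<Phi> \<and>
     (\<forall>\<alpha>\<in>sections \<A> A UNIV. \<forall>\<beta>\<in>sections \<A> A UNIV.
        (\<lambda>m. \<Phi> m (br \<alpha> \<beta> m)) = br' (\<lambda>m. \<Phi> m (\<alpha> m)) (\<lambda>m. \<Phi> m (\<beta> m))) \<and>
     (\<forall>m. \<forall>a\<in>fiber A m. \<rho>' m (\<Phi> m a) = \<rho> m a)"


section \<open>The real part of a complex Lie algebroid\<close>

definition anchor1 :: "('m \<Rightarrow> 'v \<Rightarrow> ('m, 'e) ctvec) \<Rightarrow> 'm \<Rightarrow> 'v \<Rightarrow> ('m, 'e) tvec" where
  "anchor1 \<rho> m a = fst (\<rho> m a)"

definition anchor2 :: "('m \<Rightarrow> 'v \<Rightarrow> ('m, 'e) ctvec) \<Rightarrow> 'm \<Rightarrow> 'v \<Rightarrow> ('m, 'e) tvec" where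
  "anchor2 \<rho> m a = snd (\<rho> m a)"

definition re_fiber ::
    "('m, 'v, complex) vbundle \<Rightarrow> ('m \<Rightarrow> 'v \<Rightarrow> ('m, 'e::real_inner) ctvec) \<Rightarrow> 'm \<Rightarrow> 'v set" where
  "re_fiber A \<rho> m = {a \<in> fiber A m. anchor2 \<rho> m a = 0}"

definition real_rank ::
    "('m, 'v::ab_group_add, complex) vbundle \<Rightarrow> ('m \<Rightarrow> 'v \<Rightarrow> ('m, 'e::real_inner) ctvec) \<Rightarrow> 'm \<Rightarrow> nat" where
  "real_rank A \<rho> m = vector_space.dim (real_scale A) (re_fiber A \<rho> m)"

definition mult_i :: "('m, 'v, complex) vbundle \<Rightarrow> 'm \<Rightarrow> 'v \<Rightarrow> 'v" where
  "mult_i A m a = scale A \<i> a"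

definition anchor_re :: "('m \<Rightarrow> 'v \<Rightarrow> ('m, 'e) ctvec) \<Rightarrow> 'm \<Rightarrow> 'v \<Rightarrow> ('m, 'e) tvec" where
  "anchor_re \<rho> m a = anchor1 \<rho> m a"

text \<open>With these signs, multiplication by \<open>\<i>\<close> respects brackets and anchors as a map from
  \<open>i_re_bundle\<close> to \<open>re_bundle\<close> (both below). In the opposite direction it changes the sign of
  both, and the isomorphism is its negative.\<close>

definition anchor_im :: "('m \<Rightarrow> 'v \<Rightarrow> ('m, 'e::real_inner) ctvec) \<Rightarrow> 'm \<Rightarrow> 'v \<Rightarrow> ('m, 'e) tvec" where
  "anchor_im \<rho> m a = - anchor2 \<rho> m a"

definition i_bracket :: "('m, 'v, complex) vbundle \<Rightarrow>
     (('m \<Rightarrow> 'v) \<Rightarrow> ('m \<Rightarrow> 'v) \<Rightarrow> 'm \<Rightarrow> 'v) \<Rightarrow> ('m \<Rightarrow> 'v) \<Rightarrow> ('m \<Rightarrow> 'v) \<Rightarrow> 'm \<Rightarrow> 'v" where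
  "i_bracket A br \<alpha> \<beta> = (\<lambda>m. mult_i A m (br \<alpha> \<beta> m))"

definition re_bundle ::
    "('m::topological_space, 'e::real_inner) chart set \<Rightarrow>
     ('m, 'v::ab_group_add, complex) vbundle \<Rightarrow> ('m \<Rightarrow> 'v \<Rightarrow> ('m, 'e) ctvec) \<Rightarrow> nat \<Rightarrow>
     ('m, 'v, real) vbundle" where
  "re_bundle \<A> A \<rho> k = real_subbundle \<A> A (re_fiber A \<rho>) k"

definition i_re_bundle ::
    "('m::topological_space, 'e::real_inner) chart set \<Rightarrow>
     ('m, 'v::ab_group_add, complex) vbundle \<Rightarrow> ('m \<Rightarrow> 'v \<Rightarrow> ('m, 'e) ctvec) \<Rightarrow> nat \<Rightarrow>
     ('m, 'v, real) vbundle" where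
  "i_re_bundle \<A> A \<rho> k = real_subbundle \<A> A (\<lambda>m. mult_i A m ` re_fiber A \<rho> m) k"

text \<open>The fiber of \<open>\<Delta>\<close> at \<open>m\<close>, as a subset of the complexified tangent space.\<close>

definition Delta ::
    "('m, 'e::real_inner) chart set \<Rightarrow> ('m, 'v, complex) vbundle \<Rightarrow>
     ('m \<Rightarrow> 'v \<Rightarrow> ('m, 'e) ctvec) \<Rightarrow> 'm \<Rightarrow> ('m, 'e) ctvec set" where
  "Delta \<A> A \<rho> m = \<rho> m ` fiber A m \<inter> conj_ctvec ` \<rho> m ` fiber A m \<inter> of_tvec ` tangent_space \<A> m"

end

theory Submission
  imports Defs
begin

text \<open>The fiber of the real part at \<open>m\<close> is the kernel of the real-linear map \<open>anchor2 \<rho> m\<close>, and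
  a family of kernels of constant dimension is a subbundle. This is the main analytic point of the
  proof. It is treated by elimination instead of inverting matrices of functions. If \<open>l\<close> is a smooth
  fiberwise linear functional and \<open>e\<close> a section with \<open>l e \<noteq> 0\<close> near a point, then the projection
  \<open>a \<mapsto> a - (l a / l e) e\<close> onto the kernel of \<open>l\<close> maps smooth sections to smooth sections, kills \<open>e\<close>,
  and keeps the other members of an independent family independent. Starting from a real
  frame of \<open>A\<close>, one eliminates, with functionals that vanish on the kernels, the frame vectors
  that do not lie in the kernel at the given point. When none is left, the dimension count at that
  point gives the number of remaining vectors, and constancy of the dimension shows that they span
  the kernels nearby too (\<open>frame_near\<close>). The same elimination, with arbitrary functionals, computes
  coefficients with respect to an independent family of smooth sections and so shows that
  they are smooth (\<open>smooth_coefficients\<close>). Hence the induced structure is a vector bundle, whose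
  smooth sections are the smooth sections of \<open>A\<close> with values in the kernels
  (\<open>vector_bundle_subbundle\<close>, \<open>sections_subbundle\<close>).

  The algebra is then short. Since \<open>\<rho>\<close> preserves brackets and the bracket of real vector fields is
  real, the bracket of \<open>A\<close> restricts to sections of the real part; bilinearity and the Jacobi identity
  are inherited, and the Leibniz rule restricts because \<open>\<rho> (\<alpha>) f\<close> is real when \<open>\<rho> (\<alpha>)\<close> and \<open>f\<close> are
  (\<open>re_algebroid\<close>). The second algebroid needs no separate argument: \<open>A\<close> with the bracket
  \<open>\<i> [\<alpha>, \<beta>]\<close> and the anchor \<open>\<i> \<rho>\<close> is again a complex Lie algebroid (\<open>multiply_i\<close>), and its real
  part is \<open>\<i>\<close> times the real part of \<open>A\<close>, with exactly the bracket and the anchor in question.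
  Multiplication by \<open>\<i>\<close> intertwines the two structures by complex bilinearity of the bracket and
  linearity of the anchor. Finally, an element of \<open>\<rho> (A)\<close> that is a real tangent vector is the
  value of \<open>\<rho>\<close> at a point of the kernel, which identifies the image with \<open>\<Delta>\<close>.\<close>

section \<open>Calculus of smooth functions\<close>

lemma Ck_on_subset:
  "Ck_on k S f \<Longrightarrow> T \<subseteq> S \<Longrightarrow> Ck_on k T f"
  by (induction k arbitrary: f) (auto intro: continuous_on_subset)

lemma Ck_on_has_derivative:
  "Ck_on (Suc k) S f \<Longrightarrow> x \<in> S \<Longrightarrow> (f has_derivative frechet_derivative f (at x)) (at x)"
  by (simp add: frechet_derivative_works)

lemma Ck_on_SucD: "Ck_on (Suc k) S f \<Longrightarrow> Ck_on k S f"
proof (induction k arbitrary: f)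
  case 0
  then show ?case
    by (auto intro!: continuous_at_imp_continuous_on differentiable_imp_continuous_within)
next
  case (Suc k)
  then show ?case by (metis Ck_on.simps(2))
qed

lemma Ck_on_transform:
  assumes "Ck_on k S f" "open S" "\<And>x. x \<in> S \<Longrightarrow> f x = g x"
  shows "Ck_on k S g"
  using assms(1,3)
proof (induction k arbitrary: f g)
  case 0
  then show ?case by (simp cong: continuous_on_cong)
next
  case (Suc k)
  have d: "(g has_derivative frechet_derivative f (at x)) (at x)" if "x \<in> S" for x
    using has_derivative_transform_within_open[OF Ck_on_has_derivative[OF Suc.prems(1) that]
        \<open>open S\<close> that] Suc.prems(2) by blast
  have "Ck_on k S (\<lambda>x. frechet_derivative g (at x) v)" for v
    by (rule Suc.IH[of "\<lambda>x. frechet_derivative f (at x) v"])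
      (use Suc.prems(1) frechet_derivative_at[OF d] in simp_all)
  with d show ?case by (auto simp: differentiable_def)
qed

lemma Ck_on_local:
  assumes "\<And>x. x \<in> S \<Longrightarrow> \<exists>T. open T \<and> x \<in> T \<and> Ck_on k T f"
  shows "Ck_on k S f"
  using assms
proof (induction k arbitrary: f)
  case 0
  have "isCont f x" if "x \<in> S" for x
    using 0[OF that] by (auto simp: continuous_on_eq_continuous_at)
  then show ?case by (simp add: continuous_at_imp_continuous_on)
next
  case (Suc k)
  have T: "\<exists>T. open T \<and> x \<in> T \<and> f differentiable (at x) \<and>
      (\<forall>v. Ck_on k T (\<lambda>x. frechet_derivative f (at x) v))" if "x \<in> S" for x
    using Suc.prems[OF that] by auto
  have "Ck_on k S (\<lambda>x. frechet_derivative f (at x) v)" for v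
    by (rule Suc.IH) (use T in blast)
  with T show ?case by auto
qed

lemma Ck_on_SucI:
  assumes "open S" "\<And>x. x \<in> S \<Longrightarrow> (f has_derivative D x) (at x)"
    and "\<And>v. Ck_on k S (\<lambda>x. D x v)"
  shows "Ck_on (Suc k) S f"
proof -
  have "Ck_on k S (\<lambda>x. frechet_derivative f (at x) v)" for v
    using Ck_on_transform[OF assms(3) \<open>open S\<close>] frechet_derivative_at[OF assms(2)] by simp
  with assms(2) show ?thesis by (auto simp: differentiable_def)
qed

lemma Ck_on_const: "Ck_on k S (\<lambda>x. a)"
proof (induction k arbitrary: a)
  case (Suc k)
  then show ?case by simp
qed simp

lemma Ck_on_linear:
  assumes "bounded_linear h" "open S" "Ck_on k S f"
  shows "Ck_on k S (\<lambda>x. h (f x))"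
  using assms(3)
proof (induction k arbitrary: f)
  case 0
  then show ?case by (simp add: bounded_linear.continuous_on[OF assms(1)])
next
  case (Suc k)
  have "((\<lambda>x. h (f x)) has_derivative (\<lambda>v. h (frechet_derivative f (at x) v))) (at x)"
    if "x \<in> S" for x
    using bounded_linear.has_derivative[OF assms(1) Ck_on_has_derivative[OF Suc.prems that]] .
  then show ?case
    using Suc by (intro Ck_on_SucI[OF \<open>open S\<close>]) auto
qed

lemma Ck_on_add:
  assumes "open S" "Ck_on k S f" "Ck_on k S g"
  shows "Ck_on k S (\<lambda>x. f x + g x)"
  using assms(2,3)
proof (induction k arbitrary: f g)
  case 0
  then show ?case by (simp add: continuous_on_add)
next
  case (Suc k)
  show ?case
  proof (rule Ck_on_SucI[OF \<open>open S\<close>])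
    show "((\<lambda>x. f x + g x) has_derivative
        (\<lambda>v. frechet_derivative f (at x) v + frechet_derivative g (at x) v)) (at x)" if "x \<in> S" for x
      using Suc.prems that by (intro has_derivative_add Ck_on_has_derivative)
    show "Ck_on k S (\<lambda>x. frechet_derivative f (at x) v + frechet_derivative g (at x) v)" for v
      using Suc by simp
  qed
qed

lemma Ck_on_bilinear:
  assumes h: "bounded_bilinear h" and "open S" "Ck_on k S f" "Ck_on k S g"
  shows "Ck_on k S (\<lambda>x. h (f x) (g x))"
  using assms(3,4)
proof (induction k arbitrary: f g)
  case 0
  then show ?case by (simp add: bounded_bilinear.continuous_on[OF h])
next
  case (Suc k)
  show ?case
  proof (rule Ck_on_SucI[OF \<open>open S\<close>])
    show "((\<lambda>x. h (f x) (g x)) has_derivative (\<lambda>v. h (f x) (frechet_derivative g (at x) v) +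
        h (frechet_derivative f (at x) v) (g x))) (at x)" if "x \<in> S" for x
      using Suc.prems that by (intro bounded_bilinear.FDERIV[OF h] Ck_on_has_derivative)
    have "Ck_on k S f" "Ck_on k S g"
      using Suc.prems Ck_on_SucD by blast+
    then show "Ck_on k S (\<lambda>x. h (f x) (frechet_derivative g (at x) v) +
        h (frechet_derivative f (at x) v) (g x))" for v
      using Suc by (intro Ck_on_add[OF \<open>open S\<close>] Suc.IH) auto
  qed
qed

text \<open>The derivative of the inverse involves only the inverse itself and the derivative of
  \<open>f\<close>, so the induction on the order of differentiability closes.\<close>

lemma Ck_on_inverse:
  fixes f :: "'a::real_normed_vector \<Rightarrow> real"
  assumes "open S" "\<And>x. x \<in> S \<Longrightarrow> f x \<noteq> 0" "Ck_on k S f"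
  shows "Ck_on k S (\<lambda>x. inverse (f x))"
  using assms(3)
proof (induction k)
  case 0
  with assms(2) show ?case by (auto intro!: continuous_on_inverse)
next
  case (Suc k)
  note mult = Ck_on_bilinear[OF bounded_bilinear_mult \<open>open S\<close>]
  note minus = Ck_on_linear[OF bounded_linear_minus[OF bounded_linear_ident] \<open>open S\<close>]
  show ?case
  proof (rule Ck_on_SucI[OF \<open>open S\<close>])
    show "((\<lambda>x. inverse (f x)) has_derivative
        (\<lambda>v. - (inverse (f x) * frechet_derivative f (at x) v * inverse (f x)))) (at x)"
      if "x \<in> S" for x
      using assms(2)[OF that] Suc.prems that by (intro Deriv.has_derivative_inverse Ck_on_has_derivative)
    have "Ck_on k S (\<lambda>x. inverse (f x))"
      using Suc Ck_on_SucD by blast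
    then show "Ck_on k S (\<lambda>x. - (inverse (f x) * frechet_derivative f (at x) v * inverse (f x)))" for v
      using Suc.prems by (intro minus mult) auto
  qed
qed

locale manifold =
  fixes \<A> :: "('m::{t2_space,second_countable_topology}, 'e::real_inner) chart set"
  assumes smooth_manifold: "smooth_manifold \<A>"
begin

lemma chart_around: obtains c where "c \<in> \<A>" "p \<in> fst c"
  using smooth_manifold unfolding smooth_manifold_def by blast

lemma chart_homeomorphism:
  "c \<in> \<A> \<Longrightarrow> homeomorphism (fst c) (snd c ` fst c) (snd c) (cinv c)"
  using smooth_manifold unfolding smooth_manifold_def by blast

lemma open_chart: "c \<in> \<A> \<Longrightarrow> open (fst c)"
  using smooth_manifold unfolding smooth_manifold_def by blast

lemma open_chart_image:
  assumes "c \<in> \<A>" "open W"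
  shows "open (snd c ` (fst c \<inter> W))"
proof -
  have "open (snd c ` fst c)"
    using smooth_manifold assms unfolding smooth_manifold_def by blast
  moreover have "openin (top_of_set (snd c ` fst c)) (snd c ` (fst c \<inter> W))"
    using homeomorphism_imp_open_map[OF chart_homeomorphism[OF assms(1)]] assms(2)
    by (simp add: openin_open_Int)
  ultimately show ?thesis by (metis openin_open_trans)
qed

lemma cinv_chart: "c \<in> \<A> \<Longrightarrow> p \<in> fst c \<Longrightarrow> cinv c (snd c p) = p"
  by (rule homeomorphism_apply1[OF chart_homeomorphism])

lemma smooth_fun_iff:
  "smooth_fun \<A> W f \<longleftrightarrow> (\<forall>c\<in>\<A>. \<forall>k. Ck_on k (snd c ` (fst c \<inter> W)) (\<lambda>x. f (cinv c x)))"
  by (simp add: smooth_fun_def smooth_on_def comp_def)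

lemma smooth_fun_subset: "smooth_fun \<A> W f \<Longrightarrow> V \<subseteq> W \<Longrightarrow> smooth_fun \<A> V f"
  unfolding smooth_fun_iff by (meson Ck_on_subset Int_mono image_mono order_refl)

lemma smooth_fun_transform:
  assumes "smooth_fun \<A> W f" "open W" "\<And>p. p \<in> W \<Longrightarrow> f p = g p"
  shows "smooth_fun \<A> W g"
  unfolding smooth_fun_iff
proof (intro ballI allI)
  fix c k assume c: "c \<in> \<A>"
  show "Ck_on k (snd c ` (fst c \<inter> W)) (\<lambda>x. g (cinv c x))"
  proof (rule Ck_on_transform)
    show "Ck_on k (snd c ` (fst c \<inter> W)) (\<lambda>x. f (cinv c x))"
      using assms(1) c by (simp add: smooth_fun_iff)
    show "f (cinv c x) = g (cinv c x)" if "x \<in> snd c ` (fst c \<inter> W)" for x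
      using that assms(3) cinv_chart[OF c] by force
  qed (rule open_chart_image[OF c assms(2)])
qed

lemma smooth_fun_local:
  assumes "\<And>p. p \<in> W \<Longrightarrow> \<exists>V. open V \<and> p \<in> V \<and> smooth_fun \<A> V f"
  shows "smooth_fun \<A> W f"
  unfolding smooth_fun_iff
proof (intro ballI allI Ck_on_local)
  fix c k x assume c: "c \<in> \<A>" and "x \<in> snd c ` (fst c \<inter> W)"
  then obtain p where p: "x = snd c p" "p \<in> fst c" "p \<in> W" by blast
  then obtain V where "open V" "p \<in> V" "smooth_fun \<A> V f"
    using assms by blast
  with p c show "\<exists>T. open T \<and> x \<in> T \<and> Ck_on k T (\<lambda>x. f (cinv c x))"
    unfolding smooth_fun_iff by (intro exI[of _ "snd c ` (fst c \<inter> V)"]) (auto intro: open_chart_image)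
qed

lemma smooth_fun_const: "smooth_fun \<A> W (\<lambda>p. a)"
  by (simp add: smooth_fun_iff Ck_on_const)

lemma smooth_fun_linear:
  "bounded_linear h \<Longrightarrow> open W \<Longrightarrow> smooth_fun \<A> W f \<Longrightarrow> smooth_fun \<A> W (\<lambda>p. h (f p))"
  unfolding smooth_fun_iff by (intro ballI allI, rule Ck_on_linear) (auto intro: open_chart_image)

lemma smooth_fun_minus: "open W \<Longrightarrow> smooth_fun \<A> W f \<Longrightarrow> smooth_fun \<A> W (\<lambda>p. - f p)"
  by (rule smooth_fun_linear[OF bounded_linear_minus[OF bounded_linear_ident]])

lemma smooth_fun_add:
  "open W \<Longrightarrow> smooth_fun \<A> W f \<Longrightarrow> smooth_fun \<A> W g \<Longrightarrow> smooth_fun \<A> W (\<lambda>p. f p + g p)"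
  unfolding smooth_fun_iff by (intro ballI allI, rule Ck_on_add) (auto intro: open_chart_image)

lemma smooth_fun_diff:
  "open W \<Longrightarrow> smooth_fun \<A> W f \<Longrightarrow> smooth_fun \<A> W g \<Longrightarrow> smooth_fun \<A> W (\<lambda>p. f p - g p)"
  using smooth_fun_add[of W f "\<lambda>p. - g p"] smooth_fun_minus[of W g] by simp

lemma smooth_fun_sum:
  assumes "open W" "\<And>i. i \<in> I \<Longrightarrow> smooth_fun \<A> W (f i)"
  shows "smooth_fun \<A> W (\<lambda>p. \<Sum>i\<in>I. f i p)"
  using assms(2)
  by (induction I rule: infinite_finite_induct) (auto intro: smooth_fun_add smooth_fun_const assms(1))

lemma smooth_fun_bilinear:
  "bounded_bilinear h \<Longrightarrow> open W \<Longrightarrow> smooth_fun \<A> W f \<Longrightarrow> smooth_fun \<A> W g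
    \<Longrightarrow> smooth_fun \<A> W (\<lambda>p. h (f p) (g p))"
  unfolding smooth_fun_iff by (intro ballI allI, rule Ck_on_bilinear) (auto intro: open_chart_image)

lemmas smooth_fun_mult = smooth_fun_bilinear[OF bounded_bilinear_mult]
lemmas smooth_fun_scaleR = smooth_fun_bilinear[OF bounded_bilinear_scaleR]

lemma smooth_fun_divide:
  fixes f g :: "'m \<Rightarrow> real"
  assumes "open W" "smooth_fun \<A> W f" "smooth_fun \<A> W g" "\<And>p. p \<in> W \<Longrightarrow> g p \<noteq> 0"
  shows "smooth_fun \<A> W (\<lambda>p. f p / g p)"
proof -
  have "smooth_fun \<A> W (\<lambda>p. inverse (g p))"
    unfolding smooth_fun_iff
  proof (intro ballI allI)
    fix c k assume c: "c \<in> \<A>"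
    show "Ck_on k (snd c ` (fst c \<inter> W)) (\<lambda>x. inverse (g (cinv c x)))"
    proof (rule Ck_on_inverse)
      show "g (cinv c x) \<noteq> 0" if "x \<in> snd c ` (fst c \<inter> W)" for x
        using that assms(4) cinv_chart[OF c] by force
    qed (use c assms(1,3) in \<open>auto simp: smooth_fun_iff open_chart_image\<close>)
  qed
  then show ?thesis
    using smooth_fun_mult[OF assms(1,2)] by (simp add: divide_inverse)
qed

lemma smooth_fun_continuous:
  assumes "open W" "smooth_fun \<A> W f"
  shows "continuous_on W f"
proof (rule continuous_at_imp_continuous_on, rule ballI)
  fix p assume "p \<in> W"
  obtain c where c: "c \<in> \<A>" "p \<in> fst c" by (rule chart_around)
  have "continuous_on (snd c ` (fst c \<inter> W)) (\<lambda>x. f (cinv c x))"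
    using assms(2) c unfolding smooth_fun_iff by (metis Ck_on.simps(1))
  moreover have "continuous_on (fst c \<inter> W) (snd c)"
    using chart_homeomorphism[OF c(1)] by (meson continuous_on_subset homeomorphism_def inf_le1)
  ultimately have "continuous_on (fst c \<inter> W) (\<lambda>q. f (cinv c (snd c q)))"
    by (rule continuous_on_compose2) simp
  then have "continuous_on (fst c \<inter> W) f"
    by (rule continuous_on_eq) (simp add: cinv_chart c)
  then show "isCont f p"
    using c \<open>p \<in> W\<close> assms(1) open_chart by (simp add: continuous_on_eq_continuous_at open_Int)
qed

lemma smooth_fun_differentiable:
  assumes "smooth_fun \<A> W f" "p \<in> W" "c \<in> \<A>" "p \<in> fst c"
  shows "(f \<circ> cinv c) differentiable (at (snd c p))"
proof -
  have "Ck_on (Suc 0) (snd c ` (fst c \<inter> W)) (f \<circ> cinv c)"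
    using assms unfolding smooth_fun_def smooth_on_def by blast
  with assms show ?thesis by auto
qed

end

section \<open>Eliminating a vector with a linear functional\<close>

no_notation vector_scalar_mult (infixl "*s" 70)

text \<open>A locale of its own, so that these notions are not instantiated for every existing
  interpretation of \<open>vector_space\<close>.\<close>

locale linear_elimination = vector_space scale
  for scale :: "'a::field \<Rightarrow> 'b::ab_group_add \<Rightarrow> 'b" (infixr "*s" 75)
begin

definition functional_on :: "'b set \<Rightarrow> ('b \<Rightarrow> 'a) \<Rightarrow> bool" where
  "functional_on F l \<longleftrightarrow> (\<forall>a\<in>F. (\<forall>b\<in>F. l (a + b) = l a + l b) \<and> (\<forall>r. l (r *s a) = r * l a))"

text \<open>The projection onto the kernel of \<open>l\<close> along \<open>b\<close>, if \<open>l b \<noteq> 0\<close>. On the kernel it is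
  the identity for every \<open>b\<close>.\<close>

definition eliminate :: "('b \<Rightarrow> 'a) \<Rightarrow> 'b \<Rightarrow> 'b \<Rightarrow> 'b" where
  "eliminate l b a = a - (l a / l b) *s b"

text \<open>Families, not sets: frames are given by functions of the base point, and elimination
  changes all of their members while keeping the index set.\<close>

definition independent_family :: "'i set \<Rightarrow> ('i \<Rightarrow> 'b) \<Rightarrow> bool" where
  "independent_family I f \<longleftrightarrow> (\<forall>y. (\<Sum>i\<in>I. y i *s f i) = 0 \<longrightarrow> (\<forall>i\<in>I. y i = 0))"

lemma functional_on_sum:
  assumes "subspace F" "functional_on F l" "\<And>i. i \<in> I \<Longrightarrow> f i \<in> F"
  shows "l (\<Sum>i\<in>I. y i *s f i) = (\<Sum>i\<in>I. y i * l (f i))"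
proof -
  have 0: "l 0 = 0"
    using assms(1,2) subspace_0 unfolding functional_on_def by (metis mult_zero_left scale_zero_left)
  have "(\<Sum>i\<in>I. y i *s f i) \<in> F \<and> l (\<Sum>i\<in>I. y i *s f i) = (\<Sum>i\<in>I. y i * l (f i))"
    using assms(3)
  proof (induction I rule: infinite_finite_induct)
    case (insert i I)
    then show ?case
      using assms(1,2) unfolding functional_on_def by (simp add: subspace_add subspace_scale)
  qed (auto simp: 0 subspace_0 assms(1))
  then show ?thesis ..
qed

lemma eliminate_sum:
  assumes "subspace F" "functional_on F l" "\<And>i. i \<in> I \<Longrightarrow> f i \<in> F"
  shows "eliminate l b (\<Sum>i\<in>I. y i *s f i) = (\<Sum>i\<in>I. y i *s eliminate l b (f i))"
proof -
  have "l (\<Sum>i\<in>I. y i *s f i) = (\<Sum>i\<in>I. y i * l (f i))"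
    using assms by (rule functional_on_sum)
  then show ?thesis
    by (simp add: eliminate_def scale_right_diff_distrib sum_subtractf sum_divide_distrib scale_sum_left)
qed

lemma eliminate_self: "l b \<noteq> 0 \<Longrightarrow> eliminate l b b = 0"
  by (simp add: eliminate_def)

text \<open>The term of \<open>j\<close> disappears because elimination kills \<open>f j\<close>; the other coefficients
  do not change.\<close>

lemma combination_eliminate:
  assumes "subspace F" "functional_on F l" "\<And>i. i \<in> I \<Longrightarrow> f i \<in> F"
    and "finite I" "j \<in> I" "l (f j) \<noteq> 0"
  shows "eliminate l (f j) (\<Sum>i\<in>I. y i *s f i) = (\<Sum>i\<in>I-{j}. y i *s eliminate l (f j) (f i))"
proof -
  have "eliminate l (f j) (\<Sum>i\<in>I. y i *s f i) = (\<Sum>i\<in>I. y i *s eliminate l (f j) (f i))"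
    using assms(1-3) by (rule eliminate_sum)
  then show ?thesis
    using assms(4-6) by (simp add: sum.remove[of I j "\<lambda>i. y i *s eliminate l (f j) (f i)"] eliminate_self)
qed

lemma independent_family_nonzero:
  fixes f :: "'i \<Rightarrow> 'b"
  assumes "independent_family I f" "finite I" "j \<in> I"
  shows "f j \<noteq> 0"
proof
  assume "f j = 0"
  define y :: "'i \<Rightarrow> 'a" where "y i = (if i = j then 1 else 0)" for i
  have "(\<Sum>i\<in>I. y i *s f i) = 0"
    by (rule sum.neutral) (auto simp: y_def \<open>f j = 0\<close>)
  then have "y j = 0"
    using assms(1,3) unfolding independent_family_def by blast
  then show False by (simp add: y_def)
qed

text \<open>A relation between the eliminated vectors is a relation between the original ones in
  which \<open>f j\<close> gets a coefficient determined by the others.\<close>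

lemma independent_family_eliminate:
  assumes "independent_family I f" "finite I" "j \<in> I" 
  shows "independent_family (I-{j}) (\<lambda>i. eliminate l (f j) (f i))"
  unfolding independent_family_def
proof (intro allI impI ballI)
  fix y i
  assume 0: "(\<Sum>i\<in>I-{j}. y i *s eliminate l (f j) (f i)) = 0" and i: "i \<in> I-{j}"
  \<comment> \<open>The coefficient of \<open>f j\<close> collects what elimination subtracts from the other vectors.\<close>
  define z where "z = y (j := - (\<Sum>i\<in>I-{j}. y i * (l (f i) / l (f j))))"
  have "(\<Sum>i\<in>I. z i *s f i) = (\<Sum>i\<in>I-{j}. y i *s eliminate l (f j) (f i))"
    using assms(2,3)
    by (simp add: z_def sum.remove eliminate_def scale_right_diff_distrib sum_subtractf scale_sum_left)
  with 0 assms(1) i have "z i = 0" unfolding independent_family_def by simp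
  with i show "y i = 0" by (simp add: z_def)
qed

lemma independent_family_image:
  fixes f :: "'i \<Rightarrow> 'b"
  assumes "independent_family I f" "finite I"
  shows "inj_on f I" "independent (f ` I)" "span (f ` I) = range (\<lambda>y. \<Sum>i\<in>I. y i *s f i)"
proof -
  show inj: "inj_on f I"
  proof (rule inj_onI, rule ccontr)
    fix i j assume ij: "i \<in> I" "j \<in> I" "f i = f j" "i \<noteq> j"
    define y :: "'i \<Rightarrow> 'a" where "y k = (if k = i then 1 else if k = j then - 1 else 0)" for k
    have "(\<Sum>k\<in>I. y k *s f k) = (\<Sum>k\<in>{i,j}. y k *s f k)"
      using ij assms(2) by (intro sum.mono_neutral_right) (auto simp: y_def)
    also have "\<dots> = 0" using ij by (simp add: y_def)
    finally have "y i = 0" using assms(1) ij(1) unfolding independent_family_def by blast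
    then show False by (simp add: y_def)
  qed
  have re: "(\<Sum>v\<in>f ` I. u v *s v) = (\<Sum>i\<in>I. u (f i) *s f i)" for u
    using inj by (simp add: sum.reindex)
  show "independent (f ` I)"
  proof
    assume "dependent (f ` I)"
    then obtain u v where u: "v \<in> f ` I" "u v \<noteq> 0" "(\<Sum>v\<in>f ` I. u v *s v) = 0"
      unfolding dependent_finite[OF finite_imageI[OF assms(2)]] by blast
    then have "\<forall>i\<in>I. u (f i) = 0"
      using assms(1)[unfolded independent_family_def, rule_format, of "\<lambda>i. u (f i)"] re by simp
    with u show False by blast
  qed
  show "span (f ` I) = range (\<lambda>y. \<Sum>i\<in>I. y i *s f i)"
    unfolding span_finite[OF finite_imageI[OF assms(2)]] re
  proof (intro equalityI image_subsetI)
    fix y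
    have "(\<Sum>i\<in>I. y i *s f i) = (\<Sum>i\<in>I. y (inv_into I f (f i)) *s f i)"
      by (rule sum.cong) (auto simp: inj)
    then show "(\<Sum>i\<in>I. y i *s f i) \<in> range (\<lambda>u. \<Sum>i\<in>I. u (f i) *s f i)"
      by (rule image_eqI[where x = "\<lambda>v. y (inv_into I f v)"]) simp
  next
    fix u
    show "(\<Sum>i\<in>I. u (f i) *s f i) \<in> range (\<lambda>y. \<Sum>i\<in>I. y i *s f i)"
      by (rule image_eqI[where x = "\<lambda>i. u (f i)"]) simp_all
  qed
qed

lemma subspace_combination:
  assumes "subspace S" "\<And>i. i \<in> I \<Longrightarrow> f i \<in> S"
  shows "(\<Sum>i\<in>I. y i *s f i) \<in> S"
  using assms by (intro subspace_sum subspace_scale)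

lemma dim_eq_card_family:
  assumes "independent_family I f" "finite I" "\<And>i. i \<in> I \<Longrightarrow> f i \<in> S"
    and "S \<subseteq> range (\<lambda>y. \<Sum>i\<in>I. y i *s f i)"
  shows "dim S = card I"
  using independent_family_image[OF assms(1,2)] assms(3,4)
  by (intro dim_unique[of "f ` I"]) (auto simp: card_image)

text \<open>A basis of \<open>S\<close> has as many elements as the family, so it cannot be enlarged inside the
  span of the family; hence \<open>S\<close> is all of that span.\<close>

lemma family_spans_if_card_eq_dim:
  assumes "independent_family I f" "finite I" "subspace S"
    and "S \<subseteq> range (\<lambda>y. \<Sum>i\<in>I. y i *s f i)" "dim S = card I"
  shows "S = range (\<lambda>y. \<Sum>i\<in>I. y i *s f i)"
proof -
  note im = independent_family_image[OF assms(1,2)]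
  obtain B where B: "B \<subseteq> S" "independent B" "S \<subseteq> span B" "card B = dim S"
    using basis_exists by blast
  have fin: "finite T \<and> card T \<le> card I" if "independent T" "T \<subseteq> span (f ` I)" for T
    using independent_span_bound[of "f ` I" T] that assms(2) im(1) by (simp add: card_image)
  have "finite B" using B assms(4) fin im(3) by blast
  have "f i \<in> S" if "i \<in> I" for i
  proof (rule ccontr)
    assume "f i \<notin> S"
    then have n: "f i \<notin> span B"
      using span_minimal[OF B(1) assms(3)] by blast
    then have "f i \<notin> B" using span_base by blast
    have "insert (f i) B \<subseteq> span (f ` I)"
      using B(1) assms(4) im(3) span_base[of "f i" "f ` I"] that by blast
    then have "card (insert (f i) B) \<le> card I"
      using fin independent_insertI[OF n B(2)] by blast
    with \<open>f i \<notin> B\<close> \<open>finite B\<close> B(4) assms(5) show False by simp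
  qed
  then have "range (\<lambda>y. \<Sum>i\<in>I. y i *s f i) \<subseteq> S"
    by (intro image_subsetI subspace_combination[OF assms(3)])
  with assms(4) show ?thesis by (rule equalityI)
qed

end

section \<open>Coordinates and frames of a single fiber\<close>

definition unit_coord :: "nat \<Rightarrow> nat \<Rightarrow> 'k::zero_neq_one" where
  "unit_coord i = (\<lambda>j. if j = i then 1 else 0)"

lemma unit_coord_space: "i < r \<Longrightarrow> unit_coord i \<in> coord_space r"
  by (auto simp: unit_coord_def coord_space_def)

lemma fiberwise_iso_inv_into:
  assumes "fiberwise_iso sc F r t" "x \<in> coord_space r"
  shows "inv_into F t x \<in> F" "t (inv_into F t x) = x"
  using assms unfolding fiberwise_iso_def bij_betw_def
  by (metis inv_into_into, metis f_inv_into_f)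

lemma fiberwise_iso_combination:
  assumes "linear_elimination sc" "module.subspace sc F" "fiberwise_iso sc F r t"
    and "\<And>i. i \<in> I \<Longrightarrow> f i \<in> F"
  shows "t (\<Sum>i\<in>I. sc (y i) (f i)) j = (\<Sum>i\<in>I. y i * t (f i) j)"
proof -
  interpret linear_elimination sc by fact
  have "functional_on F (\<lambda>a. t a j)"
    using assms(3) unfolding functional_on_def fiberwise_iso_def by blast
  from functional_on_sum[OF assms(2) this] assms(4) show ?thesis by blast
qed

text \<open>The preimages of the coordinate vectors under an isomorphism with the coordinate space form
  a basis, with respect to which the isomorphism gives the coordinates.\<close>

lemma fiberwise_iso_expansion:
  assumes "linear_elimination sc" "module.subspace sc F" "fiberwise_iso sc F r t"
  shows "a \<in> F \<Longrightarrow> a = (\<Sum>i<r. sc (t a i) (inv_into F t (unit_coord i)))"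
    and "linear_elimination.independent_family sc {..<r} (\<lambda>i. inv_into F t (unit_coord i))"
proof -
  interpret linear_elimination sc by fact
  let ?e = "\<lambda>i. inv_into F t (unit_coord i)"
  have e: "?e i \<in> F" "t (?e i) = unit_coord i" if "i \<in> {..<r}" for i
    using fiberwise_iso_inv_into[OF assms(3) unit_coord_space[of i r]] that by auto
  have t: "t (\<Sum>i<r. sc (y i) (?e i)) j = (if j < r then y j else 0)" for y j
  proof -
    have "t (\<Sum>i<r. sc (y i) (?e i)) j = (\<Sum>i<r. y i * t (?e i) j)"
      by (rule fiberwise_iso_combination[OF assms(1,2,3)]) (rule e)
    also have "\<dots> = (\<Sum>i<r. if i = j then y j else 0)"
    proof (rule sum.cong[OF refl])
      show "y i * t (?e i) j = (if i = j then y j else 0)" if "i \<in> {..<r}" for i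
        unfolding e(2)[OF that] by (simp add: unit_coord_def)
    qed
    finally show ?thesis by simp
  qed
  {
    assume a: "a \<in> F"
    have "(\<Sum>i<r. sc (t a i) (?e i)) \<in> F"
      using assms(2) e by (intro subspace_combination) auto
    moreover have "t a \<in> coord_space r"
      using assms(3) a unfolding fiberwise_iso_def bij_betw_def by blast
    then have "t (\<Sum>i<r. sc (t a i) (?e i)) = t a"
      by (auto simp: t fun_eq_iff coord_space_def)
    ultimately show "a = (\<Sum>i<r. sc (t a i) (?e i))"
      using inj_onD[of t F] assms(3) a unfolding fiberwise_iso_def bij_betw_def by metis
  }
  show "independent_family {..<r} ?e"
    unfolding independent_family_def
  proof (intro allI impI ballI)
    fix y i assume y: "(\<Sum>i<r. sc (y i) (?e i)) = 0" and i: "i \<in> {..<r}"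
    have "t 0 i = 0"
      using assms(3) subspace_0[OF assms(2)] unfolding fiberwise_iso_def
      by (metis (no_types, lifting) mult_zero_left scale_zero_left)
    with t[of y i] y i show "y i = 0" by simp
  qed
qed

text \<open>Converse of \<open>fiberwise_iso_expansion\<close>: a basis of a fiber determines a trivialization of it,
  with the basis as its coordinate vectors.\<close>

lemma fiberwise_iso_of_basis:
  assumes "linear_elimination sc" "module.subspace sc F"
    and indep: "linear_elimination.independent_family sc {..<r} f"
    and span: "F = range (\<lambda>y. \<Sum>i<r. sc (y i) (f i))"
  defines "t \<equiv> inv_into (coord_space r) (\<lambda>y. \<Sum>i<r. sc (y i) (f i))"
  shows "fiberwise_iso sc F r t"
    and "x \<in> coord_space r \<Longrightarrow> inv_into F t x = (\<Sum>i<r. sc (x i) (f i))"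
proof -
  interpret linear_elimination sc by fact
  let ?g = "\<lambda>y. \<Sum>i<r. sc (y i) (f i)"
  have inj: "inj_on ?g (coord_space r)"
  proof (rule inj_onI)
    fix x y assume xy: "x \<in> coord_space r" "y \<in> coord_space r" "?g x = ?g y"
    then have "?g (\<lambda>i. x i - y i) = 0"
      by (simp add: scale_left_diff_distrib sum_subtractf)
    then have "\<forall>i\<in>{..<r}. x i - y i = 0"
      using indep[unfolded independent_family_def, rule_format, of "\<lambda>i. x i - y i"] by blast
    with xy show "x = y" by (force simp: coord_space_def fun_eq_iff not_less[symmetric])
  qed
  have im: "?g ` coord_space r = F"
  proof (intro equalityI subsetI)
    fix a assume "a \<in> F"
    then obtain y where y: "a = ?g y" using span by blast
    have "a = ?g (\<lambda>i. if i < r then y i else 0)"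
      unfolding y by (rule sum.cong) auto
    then show "a \<in> ?g ` coord_space r"
      by (rule image_eqI[where x = "\<lambda>i. if i < r then y i else 0"]) (simp add: coord_space_def)
  qed (use span in blast)
  have bij: "bij_betw ?g (coord_space r) F"
    using inj im by (simp add: bij_betw_def)
  then have bij_t: "bij_betw t F (coord_space r)"
    unfolding t_def by (rule bij_betw_inv_into)
  have t: "t (?g x) = x" if "x \<in> coord_space r" for x
    unfolding t_def using inj that by (rule inv_into_f_f)
  show "fiberwise_iso sc F r t"
    unfolding fiberwise_iso_def
  proof (intro conjI bij_t ballI allI)
    fix a b i assume "a \<in> F" "b \<in> F"
    then obtain x y where xy: "x \<in> coord_space r" "a = ?g x" "y \<in> coord_space r" "b = ?g y"
      unfolding im[symmetric] by blast
    have "a + b = ?g (\<lambda>i. x i + y i)" "(\<lambda>i. x i + y i) \<in> coord_space r"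
      using xy by (simp_all add: scale_left_distrib sum.distrib coord_space_def)
    then show "t (a + b) i = t a i + t b i" using xy t by simp
  next
    fix z a i assume "a \<in> F"
    then obtain x where x: "x \<in> coord_space r" "a = ?g x"
      unfolding im[symmetric] by blast
    have "sc z a = ?g (\<lambda>i. z * x i)" "(\<lambda>i. z * x i) \<in> coord_space r"
      using x by (simp_all add: scale_sum_right coord_space_def)
    then show "t (sc z a) i = z * t a i" using x t by simp
  qed
  show "inv_into F t x = ?g x" if "x \<in> coord_space r"
    by (rule inv_into_f_eq) (use bij_t t[OF that] im that in \<open>auto simp: bij_betw_def\<close>)
qed

section \<open>Smooth sections\<close>

locale complex_bundle = manifold \<A>
  for \<A> :: "('m::{t2_space,second_countable_topology}, 'e::real_inner) chart set" +
  fixes A :: "('m, 'v::ab_group_add, complex) vbundle"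
  assumes vector_bundle: "vector_bundle \<A> A"
begin

sublocale C: linear_elimination "scale A"
  using vector_bundle by (simp add: vector_bundle_def linear_elimination_def)

sublocale R: linear_elimination "real_scale A"
  by unfold_locales
    (simp_all add: real_scale_def C.scale_right_distrib C.scale_left_distrib)

lemma subspace_fiber: "C.subspace (fiber A m)"
  using vector_bundle by (simp add: vector_bundle_def)

lemma scale_fiber: "a \<in> fiber A m \<Longrightarrow> scale A z a \<in> fiber A m"
  using C.subspace_scale[OF subspace_fiber] .

lemma add_fiber: "a \<in> fiber A m \<Longrightarrow> b \<in> fiber A m \<Longrightarrow> a + b \<in> fiber A m"
  using C.subspace_add[OF subspace_fiber] .

lemma real_subspace_fiber: "R.subspace (fiber A m)"
  using C.subspace_0[OF subspace_fiber] by (simp add: R.subspace_def real_scale_def scale_fiber add_fiber)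

lemma trivs_cover: obtains U \<tau> where "(U, \<tau>) \<in> trivs A" "p \<in> U"
proof -
  have "(\<Union>(U, \<tau>)\<in>trivs A. U) = UNIV"
    using vector_bundle by (simp add: vector_bundle_def)
  then have "p \<in> (\<Union>(U, \<tau>)\<in>trivs A. U)" by simp
  then show thesis using that by blast
qed

lemma triv_props:
  assumes "(U, \<tau>) \<in> trivs A"
  shows open_triv: "open U"
    and fiberwise_iso_triv:
      "m \<in> U \<Longrightarrow> fiberwise_iso (scale A) (fiber A m) (bundle_rank A) (\<tau> m)"
proof -
  have "\<forall>(U, \<tau>)\<in>trivs A. open U \<and>
      (\<forall>m\<in>U. fiberwise_iso (scale A) (fiber A m) (bundle_rank A) (\<tau> m))"
    using vector_bundle unfolding vector_bundle_def by (elim conjE)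
  from bspec[OF this assms] show "open U"
    "m \<in> U \<Longrightarrow> fiberwise_iso (scale A) (fiber A m) (bundle_rank A) (\<tau> m)" by auto
qed

lemma triv_transition:
  assumes "(U, \<tau>) \<in> trivs A" "(V, \<sigma>) \<in> trivs A" "x \<in> coord_space (bundle_rank A)" "i < bundle_rank A"
  shows "smooth_fun \<A> (U \<inter> V) (\<lambda>m. \<sigma> m (inv_into (fiber A m) (\<tau> m) x) i)"
proof -
  have "\<forall>(U, \<tau>)\<in>trivs A. \<forall>(V, \<sigma>)\<in>trivs A. \<forall>x\<in>coord_space (bundle_rank A). \<forall>i<bundle_rank A.
        smooth_fun \<A> (U \<inter> V) (\<lambda>m. \<sigma> m (inv_into (fiber A m) (\<tau> m) x) i)"
    using vector_bundle unfolding vector_bundle_def by (elim conjE)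
  from bspec[OF this assms(1)] assms(2-4) show ?thesis by auto
qed

lemma triv_add:
  "(U, \<tau>) \<in> trivs A \<Longrightarrow> m \<in> U \<Longrightarrow> a \<in> fiber A m \<Longrightarrow> b \<in> fiber A m
    \<Longrightarrow> \<tau> m (a + b) i = \<tau> m a i + \<tau> m b i"
  using fiberwise_iso_triv unfolding fiberwise_iso_def by blast

lemma triv_scale:
  "(U, \<tau>) \<in> trivs A \<Longrightarrow> m \<in> U \<Longrightarrow> a \<in> fiber A m \<Longrightarrow> \<tau> m (scale A z a) i = z * \<tau> m a i"
  using fiberwise_iso_triv unfolding fiberwise_iso_def by blast

lemma sections_iff:
  "s \<in> sections \<A> A W \<longleftrightarrow> (\<forall>m\<in>W. s m \<in> fiber A m) \<and>
    (\<forall>U \<tau> i. (U, \<tau>) \<in> trivs A \<longrightarrow> i < bundle_rank A \<longrightarrow> smooth_fun \<A> (W \<inter> U) (\<lambda>m. \<tau> m (s m) i))"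
  by (auto simp: sections_def)

lemma sections_fiber: "s \<in> sections \<A> A W \<Longrightarrow> m \<in> W \<Longrightarrow> s m \<in> fiber A m"
  by (simp add: sections_iff)

lemma sections_subset: "s \<in> sections \<A> A W \<Longrightarrow> V \<subseteq> W \<Longrightarrow> s \<in> sections \<A> A V"
  unfolding sections_iff using smooth_fun_subset[where V = "V \<inter> _"] by (meson Int_mono order_refl subsetD)

lemma sections_transform:
  assumes "s \<in> sections \<A> A W" "open W" "\<And>m. m \<in> W \<Longrightarrow> s m = t m"
  shows "t \<in> sections \<A> A W"
  unfolding sections_iff
proof (intro conjI ballI allI impI)
  fix U \<tau> i assume U: "(U, \<tau>) \<in> trivs A" "i < bundle_rank A"
  show "smooth_fun \<A> (W \<inter> U) (\<lambda>m. \<tau> m (t m) i)"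
    by (rule smooth_fun_transform[where f = "\<lambda>m. \<tau> m (s m) i"])
      (use assms U open_triv in \<open>auto simp: sections_iff\<close>)
qed (use assms sections_fiber in force)

lemma sections_local:
  assumes "\<And>p. p \<in> W \<Longrightarrow> \<exists>V. open V \<and> p \<in> V \<and> s \<in> sections \<A> A V"
  shows "s \<in> sections \<A> A W"
  unfolding sections_iff
proof (intro conjI ballI allI impI)
  fix U \<tau> i assume U: "(U, \<tau>) \<in> trivs A" "i < bundle_rank A"
  show "smooth_fun \<A> (W \<inter> U) (\<lambda>m. \<tau> m (s m) i)"
  proof (rule smooth_fun_local)
    fix p assume p: "p \<in> W \<inter> U"
    then obtain V where "open V" "p \<in> V" "s \<in> sections \<A> A V"
      using assms by blast
    with p U show "\<exists>V. open V \<and> p \<in> V \<and> smooth_fun \<A> V (\<lambda>m. \<tau> m (s m) i)"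
      by (intro exI[of _ "V \<inter> U"]) (auto simp: sections_iff open_triv open_Int)
  qed
qed (use assms sections_fiber in blast)

lemma sections_add:
  assumes "open W" "s \<in> sections \<A> A W" "t \<in> sections \<A> A W"
  shows "(\<lambda>m. s m + t m) \<in> sections \<A> A W"
  unfolding sections_iff
proof (intro conjI ballI allI impI)
  fix U \<tau> i assume U: "(U, \<tau>) \<in> trivs A" "i < bundle_rank A"
  have "open (W \<inter> U)" using assms(1) open_triv[OF U(1)] by blast
  show "smooth_fun \<A> (W \<inter> U) (\<lambda>m. \<tau> m (s m + t m) i)"
  proof (rule smooth_fun_transform[OF _ \<open>open (W \<inter> U)\<close>])
    show "smooth_fun \<A> (W \<inter> U) (\<lambda>m. \<tau> m (s m) i + \<tau> m (t m) i)"
      using assms U \<open>open (W \<inter> U)\<close> by (intro smooth_fun_add) (auto simp: sections_iff)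
  qed (use assms U triv_add sections_fiber in force)
qed (use assms sections_fiber add_fiber in blast)

lemma sections_scale:
  assumes "open W" "smooth_fun \<A> W z" "s \<in> sections \<A> A W"
  shows "(\<lambda>m. scale A (z m) (s m)) \<in> sections \<A> A W"
  unfolding sections_iff
proof (intro conjI ballI allI impI)
  fix U \<tau> i assume U: "(U, \<tau>) \<in> trivs A" "i < bundle_rank A"
  have "open (W \<inter> U)" using assms(1) open_triv[OF U(1)] by blast
  show "smooth_fun \<A> (W \<inter> U) (\<lambda>m. \<tau> m (scale A (z m) (s m)) i)"
  proof (rule smooth_fun_transform[OF _ \<open>open (W \<inter> U)\<close>])
    show "smooth_fun \<A> (W \<inter> U) (\<lambda>m. z m * \<tau> m (s m) i)"
      using assms U \<open>open (W \<inter> U)\<close> smooth_fun_subset[OF assms(2), of "W \<inter> U"]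
      by (intro smooth_fun_mult) (auto simp: sections_iff)
  qed (use assms U triv_scale sections_fiber in force)
qed (use assms sections_fiber scale_fiber in blast)

lemma sections_real_scale:
  assumes "open W" "smooth_fun \<A> W f" "s \<in> sections \<A> A W"
  shows "(\<lambda>m. real_scale A (f m) (s m)) \<in> sections \<A> A W"
  unfolding real_scale_def
  using assms by (intro sections_scale smooth_fun_linear[OF bounded_linear_of_real])

lemma sections_diff:
  assumes "open W" "s \<in> sections \<A> A W" "t \<in> sections \<A> A W"
  shows "(\<lambda>m. s m - t m) \<in> sections \<A> A W"
  using sections_add[OF assms(1,2) sections_scale[OF assms(1) smooth_fun_const[of _ "- 1"] assms(3)]]
  by simp

lemma zero_section: "(\<lambda>m. 0) \<in> sections \<A> A W"
  unfolding sections_iff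
proof (intro conjI ballI allI impI)
  fix U \<tau> i assume U: "(U, \<tau>) \<in> trivs A" "i < bundle_rank A"
  have "smooth_fun \<A> U (\<lambda>m. \<tau> m 0 i)"
  proof (rule smooth_fun_transform[OF smooth_fun_const open_triv[OF U(1)]])
    show "0 = \<tau> m 0 i" if "m \<in> U" for m
      using triv_scale[OF U(1) that C.subspace_0[OF subspace_fiber], of 0 i] by simp
  qed
  then show "smooth_fun \<A> (W \<inter> U) (\<lambda>m. \<tau> m 0 i)"
    by (rule smooth_fun_subset) simp
qed (rule C.subspace_0[OF subspace_fiber])

lemma sections_combination:
  assumes "open W" "finite I" "\<And>i. i \<in> I \<Longrightarrow> smooth_fun \<A> W (x i)"
    and "\<And>i. i \<in> I \<Longrightarrow> e i \<in> sections \<A> A W"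
  shows "(\<lambda>m. \<Sum>i\<in>I. real_scale A (x i m) (e i m)) \<in> sections \<A> A W"
  using assms(2-4)
proof (induction I rule: finite_induct)
  case empty
  then show ?case by (simp add: zero_section)
next
  case (insert i I)
  have "(\<lambda>m. real_scale A (x i m) (e i m) + (\<Sum>i\<in>I. real_scale A (x i m) (e i m))) \<in> sections \<A> A W"
    using insert by (intro sections_add sections_real_scale assms(1)) auto
  with insert.hyps show ?case by simp
qed

definition triv_frame :: "('m \<Rightarrow> 'v \<Rightarrow> nat \<Rightarrow> complex) \<Rightarrow> nat \<Rightarrow> 'm \<Rightarrow> 'v" where
  "triv_frame \<tau> i m = inv_into (fiber A m) (\<tau> m) (unit_coord i)"

lemma triv_frame_section:
  assumes "(U, \<tau>) \<in> trivs A" "i < bundle_rank A"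
  shows "triv_frame \<tau> i \<in> sections \<A> A U"
  unfolding sections_iff triv_frame_def
proof (intro conjI ballI allI impI)
  fix V \<sigma> j assume V: "(V, \<sigma>) \<in> trivs A" "j < bundle_rank A"
  show "smooth_fun \<A> (U \<inter> V) (\<lambda>m. \<sigma> m (inv_into (fiber A m) (\<tau> m) (unit_coord i)) j)"
    by (rule triv_transition[OF assms(1) V(1) unit_coord_space[OF assms(2)] V(2)])
qed (use assms fiberwise_iso_inv_into[OF fiberwise_iso_triv unit_coord_space] in blast)

lemma triv_frame_expansion:
  assumes "(U, \<tau>) \<in> trivs A" "m \<in> U" "a \<in> fiber A m"
  shows "a = (\<Sum>i<bundle_rank A. scale A (\<tau> m a i) (triv_frame \<tau> i m))"
  unfolding triv_frame_def
  by (rule fiberwise_iso_expansion(1)[OF C.linear_elimination_axioms subspace_fiber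
        fiberwise_iso_triv[OF assms(1,2)] assms(3)])

lemma triv_frame_independent:
  assumes "(U, \<tau>) \<in> trivs A" "m \<in> U"
  shows "C.independent_family {..<bundle_rank A} (\<lambda>i. triv_frame \<tau> i m)"
  unfolding triv_frame_def
  by (rule fiberwise_iso_expansion(2)[OF C.linear_elimination_axioms subspace_fiber
        fiberwise_iso_triv[OF assms(1,2)]])

text \<open>The vectors of a complex frame and their multiples by \<open>\<i>\<close> form a real frame. Indices with second
  component \<open>True\<close> belong to the multiples by \<open>\<i>\<close>.\<close>

lemma real_frame:
  assumes "(U, \<tau>) \<in> trivs A"
  obtains I and e :: "nat \<times> bool \<Rightarrow> 'm \<Rightarrow> 'v" where "finite I"
    "\<forall>i\<in>I. e i \<in> sections \<A> A U"
    "\<forall>m\<in>U. R.independent_family I (\<lambda>i. e i m)"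
    "\<forall>m\<in>U. fiber A m \<subseteq> range (\<lambda>y. \<Sum>i\<in>I. real_scale A (y i) (e i m))"
proof
  let ?r = "bundle_rank A"
  let ?I = "{..<?r} \<times> (UNIV :: bool set)"
  define e where "e ib m = scale A (if snd ib then \<i> else 1) (triv_frame \<tau> (fst ib) m)" for ib m
  have comb: "(\<Sum>ib\<in>?I. real_scale A (y ib) (e ib m)) =
      (\<Sum>i<?r. scale A (Complex (y (i, False)) (y (i, True))) (triv_frame \<tau> i m))" for y m
    by (simp add: sum.cartesian_product' UNIV_bool e_def real_scale_def Complex_eq
        C.scale_left_distrib mult.commute add.commute)
  show "finite ?I" by simp
  show "\<forall>ib\<in>?I. e ib \<in> sections \<A> A U"
    using assms unfolding e_def
    by (intro ballI sections_scale smooth_fun_const triv_frame_section open_triv) auto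
  have "R.independent_family ?I (\<lambda>ib. e ib m)" if m: "m \<in> U" for m
    unfolding R.independent_family_def comb
  proof (intro allI impI ballI)
    fix y :: "nat \<times> bool \<Rightarrow> real" and ib
    assume "(\<Sum>i<?r. scale A (Complex (y (i, False)) (y (i, True))) (triv_frame \<tau> i m)) = 0"
      and ib: "ib \<in> ?I"
    then have "Complex (y (fst ib, False)) (y (fst ib, True)) = 0"
      using triv_frame_independent[OF assms m] unfolding C.independent_family_def by auto
    then show "y ib = 0"
      by (cases ib; cases "snd ib") (auto simp: complex_eq_iff)
  qed
  then show "\<forall>m\<in>U. R.independent_family ?I (\<lambda>ib. e ib m)" by blast
  have "fiber A m \<subseteq> range (\<lambda>y. \<Sum>ib\<in>?I. real_scale A (y ib) (e ib m))" if m: "m \<in> U" for m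
  proof
    fix a assume a: "a \<in> fiber A m"
    let ?y = "\<lambda>ib. if snd ib then Im (\<tau> m a (fst ib)) else Re (\<tau> m a (fst ib))"
    have "a = (\<Sum>ib\<in>?I. real_scale A (?y ib) (e ib m))"
      unfolding comb using triv_frame_expansion[OF assms m a] by simp
    then show "a \<in> range (\<lambda>y. \<Sum>ib\<in>?I. real_scale A (y ib) (e ib m))"
      by (rule image_eqI[where x = ?y]) simp
  qed
  then show "\<forall>m\<in>U. fiber A m \<subseteq> range (\<lambda>y. \<Sum>ib\<in>?I. real_scale A (y ib) (e ib m))" by blast
qed

end

section \<open>Smooth fiberwise functionals and frames\<close>

context complex_bundle
begin

text \<open>Smoothness is tested on smooth sections over all open subsets, which is how functionals
  are applied below; no dual bundle is involved.\<close>

definition smooth_functional :: "'m set \<Rightarrow> ('m \<Rightarrow> 'v \<Rightarrow> real) \<Rightarrow> bool" where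
  "smooth_functional W l \<longleftrightarrow> (\<forall>m\<in>W. R.functional_on (fiber A m) (l m)) \<and>
     (\<forall>V s. open V \<longrightarrow> V \<subseteq> W \<longrightarrow> s \<in> sections \<A> A V \<longrightarrow> smooth_fun \<A> V (\<lambda>m. l m (s m)))"

text \<open>\<open>S\<close> is the common zero set of smooth functionals that are defined locally. The
  functional may depend on the vector that it separates from \<open>S\<close>.\<close>

definition cut_out :: "('m \<Rightarrow> 'v set) \<Rightarrow> bool" where
  "cut_out S \<longleftrightarrow> (\<forall>p. \<forall>a\<in>fiber A p - S p. \<exists>W l. open W \<and> p \<in> W \<and> smooth_functional W l \<and>
     (\<forall>m\<in>W. \<forall>b\<in>S m. l m b = 0) \<and> l p a \<noteq> 0)"

lemma smooth_functional_functional_on: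
  "smooth_functional W l \<Longrightarrow> m \<in> W \<Longrightarrow> R.functional_on (fiber A m) (l m)"
  by (simp add: smooth_functional_def)

lemma smooth_functional_smooth:
  "smooth_functional W l \<Longrightarrow> open V \<Longrightarrow> V \<subseteq> W \<Longrightarrow> s \<in> sections \<A> A V
    \<Longrightarrow> smooth_fun \<A> V (\<lambda>m. l m (s m))"
  by (simp add: smooth_functional_def)

lemma smooth_functional_subset: "smooth_functional W l \<Longrightarrow> V \<subseteq> W \<Longrightarrow> smooth_functional V l"
  by (auto simp: smooth_functional_def)

lemma smooth_functional_coordinate:
  assumes "(U, \<tau>) \<in> trivs A" "i < bundle_rank A" "bounded_linear h"
  shows "smooth_functional U (\<lambda>m a. h (\<tau> m a i))"
  unfolding smooth_functional_def R.functional_on_def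
proof (intro conjI ballI allI impI)
  interpret h: bounded_linear h by fact
  fix m a assume ma: "m \<in> U" "a \<in> fiber A m"
  show "h (\<tau> m (a + b) i) = h (\<tau> m a i) + h (\<tau> m b i)" if "b \<in> fiber A m" for b
    using ma that assms(1) by (simp add: triv_add h.add)
  show "h (\<tau> m (real_scale A r a) i) = r * h (\<tau> m a i)" for r
    using ma assms(1) by (simp add: real_scale_def triv_scale h.scaleR flip: scaleR_conv_of_real)
next
  fix V s assume V: "open V" "V \<subseteq> U" "s \<in> sections \<A> A V"
  then have "V \<inter> U = V" by blast
  then have "smooth_fun \<A> V (\<lambda>m. \<tau> m (s m) i)"
    using V assms(1,2) unfolding sections_iff by metis
  then show "smooth_fun \<A> V (\<lambda>m. h (\<tau> m (s m) i))"
    by (rule smooth_fun_linear[OF assms(3) V(1)])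
qed

text \<open>Real and imaginary parts of coordinates separate the points of a fiber.\<close>

lemma zero_cut_out: "cut_out (\<lambda>m. {0})"
  unfolding cut_out_def
proof (intro allI ballI)
  fix p a assume a: "a \<in> fiber A p - {0}"
  obtain U \<tau> where U: "(U, \<tau>) \<in> trivs A" "p \<in> U" by (rule trivs_cover)
  have "\<exists>i<bundle_rank A. \<tau> p a i \<noteq> 0"
  proof (rule ccontr)
    assume "\<not> ?thesis"
    then have "(\<Sum>i<bundle_rank A. scale A (\<tau> p a i) (triv_frame \<tau> i p)) = 0" by simp
    with triv_frame_expansion[OF U, of a] a show False by simp
  qed
  then obtain i where i: "i < bundle_rank A" "\<tau> p a i \<noteq> 0" by blast
  then have "Re (\<tau> p a i) \<noteq> 0 \<or> Im (\<tau> p a i) \<noteq> 0"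
    by (simp add: complex_eq_iff)
  then obtain h :: "complex \<Rightarrow> real" where h: "bounded_linear h" "h (\<tau> p a i) \<noteq> 0"
    using bounded_linear_Re bounded_linear_Im by blast
  note l = smooth_functional_coordinate[OF U(1) i(1) h(1)]
  show "\<exists>W l. open W \<and> p \<in> W \<and> smooth_functional W l \<and> (\<forall>m\<in>W. \<forall>b\<in>{0}. l m b = 0) \<and> l p a \<noteq> 0"
  proof (intro exI conjI)
    show "\<forall>m\<in>U. \<forall>b\<in>{0}. h (\<tau> m b i) = 0"
    proof (intro ballI)
      fix m b assume "m \<in> U" "b \<in> {0::'v}"
      then have "\<tau> m b i = 0"
        using triv_scale[OF U(1) _ C.subspace_0[OF subspace_fiber], of m 0 i] by simp
      then show "h (\<tau> m b i) = 0"
        using linear_0[OF bounded_linear.linear[OF h(1)]] by simp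
    qed
  qed (use U open_triv l h in auto)
qed

lemma section_eliminate:
  assumes "open W" "smooth_functional W l" "e \<in> sections \<A> A W" "s \<in> sections \<A> A W"
    and "\<And>m. m \<in> W \<Longrightarrow> l m (e m) \<noteq> 0"
  shows "(\<lambda>m. R.eliminate (l m) (e m) (s m)) \<in> sections \<A> A W"
  unfolding R.eliminate_def
  using assms by (intro sections_diff sections_real_scale smooth_fun_divide)
    (auto intro: smooth_functional_smooth)

lemma open_functional_nonzero:
  assumes "open W" "smooth_functional W l" "e \<in> sections \<A> A W"
  shows "open {m \<in> W. l m (e m) \<noteq> 0}"
proof -
  have "continuous_on W (\<lambda>m. l m (e m))"
    using assms by (intro smooth_fun_continuous smooth_functional_smooth) auto
  then have "open (W \<inter> (\<lambda>m. l m (e m)) -` (- {0}))"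
    using assms(1) by (intro continuous_open_preimage) auto
  also have "W \<inter> (\<lambda>m. l m (e m)) -` (- {0}) = {m \<in> W. l m (e m) \<noteq> 0}" by auto
  finally show ?thesis .
qed

text \<open>A vector outside \<open>S\<close> can be eliminated near the point without affecting \<open>S\<close>: a
  functional that vanishes on \<open>S\<close> but not on the vector stays nonzero on the section nearby.\<close>

lemma eliminate_step:
  assumes "cut_out S" "open W" "p \<in> W" "e \<in> sections \<A> A W" "e p \<notin> S p"
  obtains V l where "open V" "p \<in> V" "V \<subseteq> W" "smooth_functional V l"
    "\<And>m b. m \<in> V \<Longrightarrow> b \<in> S m \<Longrightarrow> l m b = 0" "\<And>m. m \<in> V \<Longrightarrow> l m (e m) \<noteq> 0"
proof -
  have "e p \<in> fiber A p - S p"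
    using assms sections_fiber by blast
  then have "\<exists>W l. open W \<and> p \<in> W \<and> smooth_functional W l \<and>
      (\<forall>m\<in>W. \<forall>b\<in>S m. l m b = 0) \<and> l p (e p) \<noteq> 0"
    using assms(1) by (simp only: cut_out_def)
  then obtain W' l where l: "open W'" "p \<in> W'" "smooth_functional W' l"
      "\<forall>m\<in>W'. \<forall>b\<in>S m. l m b = 0" "l p (e p) \<noteq> 0"
    by (elim exE conjE)
  have l': "smooth_functional (W \<inter> W') l" and e: "e \<in> sections \<A> A (W \<inter> W')"
    using smooth_functional_subset[OF l(3)] sections_subset[OF assms(4)] by blast+
  let ?V = "{m \<in> W \<inter> W'. l m (e m) \<noteq> 0}"
  have "open ?V"
    using assms(2) l(1) by (intro open_functional_nonzero l' e open_Int)
  moreover have "smooth_functional ?V l"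
    by (rule smooth_functional_subset[OF l']) blast
  ultimately show thesis
    using assms(3) l by (intro that[of ?V l]) auto
qed

text \<open>By induction on the size of the family: eliminating one member \<open>e j\<close> from \<open>s\<close> and from
  the other members does not change the other coefficients, which are thus smooth, and the
  remaining coefficient is then obtained by applying the functional to \<open>s\<close>.\<close>

lemma smooth_coefficients_near:
  fixes e :: "'i \<Rightarrow> 'm \<Rightarrow> 'v"
  assumes "finite I" "open W" "p \<in> W"
    and "\<And>i. i \<in> I \<Longrightarrow> e i \<in> sections \<A> A W" "s \<in> sections \<A> A W"
    and "\<And>m. m \<in> W \<Longrightarrow> R.independent_family I (\<lambda>i. e i m)"
    and "\<And>m. m \<in> W \<Longrightarrow> s m = (\<Sum>i\<in>I. real_scale A (x i m) (e i m))"
  shows "\<exists>V. open V \<and> p \<in> V \<and> (\<forall>i\<in>I. smooth_fun \<A> V (x i))"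
  using assms
proof (induction I arbitrary: W e s rule: finite_psubset_induct)
  case (psubset I)
  show ?case
  proof (cases "I = {}")
    case True
    with psubset.prems(1,2) show ?thesis by blast
  next
    case False
    then obtain j where j: "j \<in> I" by blast
    have "e j p \<noteq> 0"
      using R.independent_family_nonzero[OF psubset.prems(5)[OF psubset.prems(2)] psubset.hyps j] .
    then obtain V l where V: "open V" "p \<in> V" "V \<subseteq> W" "smooth_functional V l"
        and ej: "\<And>m. m \<in> V \<Longrightarrow> l m (e j m) \<noteq> 0"
      using eliminate_step[OF zero_cut_out psubset.prems(1,2) psubset.prems(3)[OF j]] by (metis singletonD)
    have eV: "e i \<in> sections \<A> A V" if "i \<in> I" for i
      using sections_subset[OF psubset.prems(3)[OF that] V(3)] .
    have sV: "s \<in> sections \<A> A V"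
      using sections_subset[OF psubset.prems(4) V(3)] .
    define e' where "e' i m = R.eliminate (l m) (e j m) (e i m)" for i m
    define s' where "s' m = R.eliminate (l m) (e j m) (s m)" for m
    have "I - {j} \<subset> I" using j by blast
    moreover have "e' i \<in> sections \<A> A V" if "i \<in> I - {j}" for i
      unfolding e'_def using that by (intro section_eliminate V eV j ej) auto
    moreover have "s' \<in> sections \<A> A V"
      unfolding s'_def by (intro section_eliminate V eV sV j ej)
    moreover have "R.independent_family (I - {j}) (\<lambda>i. e' i m)" if "m \<in> V" for m
      unfolding e'_def using psubset.prems(5) that V(3) psubset.hyps j
      by (intro R.independent_family_eliminate) auto
    moreover have "s' m = (\<Sum>i\<in>I-{j}. real_scale A (x i m) (e' i m))" if "m \<in> V" for m
    proof -
      have "s m = (\<Sum>i\<in>I. real_scale A (x i m) (e i m))"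
        using psubset.prems(6) that V(3) by blast
      then show ?thesis
        unfolding s'_def e'_def
        using R.combination_eliminate[OF real_subspace_fiber smooth_functional_functional_on[OF V(4) that],
            of I "\<lambda>i. e i m" j "\<lambda>i. x i m"] sections_fiber[OF eV that] psubset.hyps j ej[OF that] by simp
    qed
    ultimately obtain V' where V': "open V'" "p \<in> V'" "\<And>i. i \<in> I - {j} \<Longrightarrow> smooth_fun \<A> V' (x i)"
      using psubset.IH[OF _ V(1,2), of "I - {j}" e' s'] by blast
    let ?X = "V \<inter> V'"
    have X: "open ?X" using V(1) V'(1) by (rule open_Int)
    have l_smooth: "smooth_fun \<A> ?X (\<lambda>m. l m (t m))" if "t \<in> sections \<A> A V" for t
      by (rule smooth_functional_smooth[OF V(4) X _ sections_subset[OF that]]) auto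
    \<comment> \<open>The last coefficient is read off from \<open>l\<close> applied to the expansion of \<open>s\<close>.\<close>
    have "smooth_fun \<A> ?X (\<lambda>m. (l m (s m) - (\<Sum>i\<in>I-{j}. x i m * l m (e i m))) / l m (e j m))"
      using ej V'(3) smooth_fun_subset[of V' _ ?X]
      by (intro smooth_fun_divide smooth_fun_diff smooth_fun_sum smooth_fun_mult X l_smooth sV eV j) auto
    then have "smooth_fun \<A> ?X (x j)"
    proof (rule smooth_fun_transform[OF _ X])
      fix m assume m: "m \<in> ?X"
      then have "s m = (\<Sum>i\<in>I. real_scale A (x i m) (e i m))"
        using psubset.prems(6) V(3) by blast
      then have "l m (s m) = (\<Sum>i\<in>I. x i m * l m (e i m))"
        using R.functional_on_sum[OF real_subspace_fiber smooth_functional_functional_on[OF V(4)],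
            of m I "\<lambda>i. e i m" "\<lambda>i. x i m"] sections_fiber[OF eV] m by simp
      then show "(l m (s m) - (\<Sum>i\<in>I-{j}. x i m * l m (e i m))) / l m (e j m) = x j m"
        using ej[of m] m psubset.hyps j by (simp add: sum.remove[of I j])
    qed
    moreover have "smooth_fun \<A> ?X (x i)" if "i \<in> I - {j}" for i
      by (rule smooth_fun_subset[OF V'(3)[OF that]]) simp
    ultimately show ?thesis
      using X V(2) V'(2) by (intro exI[of _ ?X]) auto
  qed
qed

lemma smooth_coefficients:
  assumes "finite I" "open W"
    and "\<And>i. i \<in> I \<Longrightarrow> e i \<in> sections \<A> A W" "s \<in> sections \<A> A W"
    and "\<And>m. m \<in> W \<Longrightarrow> R.independent_family I (\<lambda>i. e i m)"
    and "\<And>m. m \<in> W \<Longrightarrow> s m = (\<Sum>i\<in>I. real_scale A (x i m) (e i m))"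
    and "i \<in> I"
  shows "smooth_fun \<A> W (x i)"
proof (rule smooth_fun_local)
  fix p assume "p \<in> W"
  then obtain V where "open V" "p \<in> V" "\<forall>i\<in>I. smooth_fun \<A> V (x i)"
    using smooth_coefficients_near[of I W p e s x] assms(1-6) by blast
  then show "\<exists>V. open V \<and> p \<in> V \<and> smooth_fun \<A> V (x i)"
    using assms(7) by blast
qed

end

section \<open>Subbundles of constant rank\<close>

locale constant_rank_family = complex_bundle \<A> A
  for \<A> :: "('m::{t2_space,second_countable_topology}, 'e::real_inner) chart set"
    and A :: "('m, 'v::ab_group_add, complex) vbundle" +
  fixes S :: "'m \<Rightarrow> 'v set" and k :: nat
  assumes subspace: "R.subspace (S m)"
    and subset_fiber: "S m \<subseteq> fiber A m"
    and cut_out: "cut_out S"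
    and dim_eq: "R.dim (S m) = k"
begin

text \<open>By induction on the size of the spanning family. A member that lies outside \<open>S\<close> at
  \<open>p\<close> is eliminated with a functional vanishing on \<open>S\<close>, so that the remaining members
  still span \<open>S\<close>. If all members lie in \<open>S\<close> at \<open>p\<close>, they form a basis there, so there are
  \<open>k\<close> of them, and as \<open>S\<close> has dimension \<open>k\<close> at the other points too, it is equal to
  their span. The members then lie in \<open>S\<close> near \<open>p\<close>, although this was only known at \<open>p\<close>.\<close>

lemma frame_near:
  fixes e :: "'i \<Rightarrow> 'm \<Rightarrow> 'v"
  assumes "finite I" "open W" "p \<in> W"
    and "\<And>i. i \<in> I \<Longrightarrow> e i \<in> sections \<A> A W"
    and "\<And>m. m \<in> W \<Longrightarrow> R.independent_family I (\<lambda>i. e i m)"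
    and "\<And>m. m \<in> W \<Longrightarrow> S m \<subseteq> range (\<lambda>y. \<Sum>i\<in>I. real_scale A (y i) (e i m))"
  shows "\<exists>(J::'i set) e V. finite J \<and> card J = k \<and> open V \<and> p \<in> V \<and>
    (\<forall>i\<in>J. e i \<in> sections \<A> A V) \<and> (\<forall>m\<in>V. R.independent_family J (\<lambda>i. e i m)) \<and>
    (\<forall>m\<in>V. S m = range (\<lambda>y. \<Sum>i\<in>J. real_scale A (y i) (e i m)))"
  using assms
proof (induction I arbitrary: W e rule: finite_psubset_induct)
  case (psubset I)
  show ?case
  proof (cases "\<forall>i\<in>I. e i p \<in> S p")
    case True
    have "k = card I"
      using R.dim_eq_card_family[OF psubset.prems(4)[OF psubset.prems(2)] psubset.hyps, of "S p"]
        True psubset.prems(5)[OF psubset.prems(2)] dim_eq by simp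
    then have "S m = range (\<lambda>y. \<Sum>i\<in>I. real_scale A (y i) (e i m))" if "m \<in> W" for m
      using R.family_spans_if_card_eq_dim[OF psubset.prems(4)[OF that] psubset.hyps subspace
          psubset.prems(5)[OF that]] dim_eq by simp
    with psubset.prems psubset.hyps \<open>k = card I\<close> show ?thesis
      by (intro exI[of _ I] exI[of _ e] exI[of _ W]) simp
  next
    case False
    then obtain j where j: "j \<in> I" "e j p \<notin> S p" by blast
    obtain V l where V: "open V" "p \<in> V" "V \<subseteq> W" "smooth_functional V l"
        and lS: "\<And>m b. m \<in> V \<Longrightarrow> b \<in> S m \<Longrightarrow> l m b = 0"
        and ej: "\<And>m. m \<in> V \<Longrightarrow> l m (e j m) \<noteq> 0"
      using eliminate_step[OF cut_out psubset.prems(1,2) psubset.prems(3)[OF j(1)] j(2)] by metis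
    have eV: "e i \<in> sections \<A> A V" if "i \<in> I" for i
      using sections_subset[OF psubset.prems(3)[OF that] V(3)] .
    define e' where "e' i m = R.eliminate (l m) (e j m) (e i m)" for i m
    have "I - {j} \<subset> I" using j by blast
    moreover have "e' i \<in> sections \<A> A V" if "i \<in> I - {j}" for i
      unfolding e'_def using that by (intro section_eliminate V eV j ej) auto
    moreover have "R.independent_family (I - {j}) (\<lambda>i. e' i m)" if "m \<in> V" for m
      unfolding e'_def using psubset.prems(4) that V(3) psubset.hyps j
      by (intro R.independent_family_eliminate) auto
    moreover have "S m \<subseteq> range (\<lambda>y. \<Sum>i\<in>I-{j}. real_scale A (y i) (e' i m))" if m: "m \<in> V" for m
    proof
      fix a assume a: "a \<in> S m"
      then obtain y where y: "a = (\<Sum>i\<in>I. real_scale A (y i) (e i m))"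
        using psubset.prems(5)[of m] m V(3) by blast
      \<comment> \<open>Elimination fixes \<open>a\<close>, since \<open>l\<close> vanishes there.\<close>
      have "a = R.eliminate (l m) (e j m) a"
        using lS[OF m a] by (simp add: R.eliminate_def)
      also have "\<dots> = (\<Sum>i\<in>I-{j}. real_scale A (y i) (e' i m))"
        unfolding y e'_def
        using R.combination_eliminate[OF real_subspace_fiber smooth_functional_functional_on[OF V(4) m],
            of I "\<lambda>i. e i m" j y] sections_fiber[OF eV m] psubset.hyps j ej[OF m] by simp
      finally show "a \<in> range (\<lambda>y. \<Sum>i\<in>I-{j}. real_scale A (y i) (e' i m))"
        by (rule image_eqI[where x = y]) simp
    qed
    ultimately show ?thesis
      using psubset.IH[OF _ V(1,2), of "I - {j}" e'] by blast
  qed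
qed

lemma basis_near:
  obtains e V where "open V" "p \<in> V" "\<forall>i<k. e i \<in> sections \<A> A V"
    "\<forall>m\<in>V. R.independent_family {..<k} (\<lambda>i. e i m)"
    "\<forall>m\<in>V. S m = range (\<lambda>y. \<Sum>i<k. real_scale A (y i) (e i m))"
proof -
  obtain U \<tau> where U: "(U, \<tau>) \<in> trivs A" "p \<in> U" by (rule trivs_cover)
  obtain I and f :: "nat \<times> bool \<Rightarrow> 'm \<Rightarrow> 'v" where f: "finite I"
    "\<forall>i\<in>I. f i \<in> sections \<A> A U"
    "\<forall>m\<in>U. R.independent_family I (\<lambda>i. f i m)"
    "\<forall>m\<in>U. fiber A m \<subseteq> range (\<lambda>y. \<Sum>i\<in>I. real_scale A (y i) (f i m))"
    by (rule real_frame[OF U(1)])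
  have "S m \<subseteq> range (\<lambda>y. \<Sum>i\<in>I. real_scale A (y i) (f i m))" if "m \<in> U" for m
    using subset_fiber bspec[OF f(4) that] by (rule order_trans)
  from frame_near[OF f(1) open_triv[OF U(1)] U(2) f(2)[rule_format] f(3)[rule_format] this]
  obtain J :: "(nat \<times> bool) set" and g V where g: "finite J" "card J = k" "open V" "p \<in> V"
    "\<forall>i\<in>J. g i \<in> sections \<A> A V" "\<forall>m\<in>V. R.independent_family J (\<lambda>i. g i m)"
    "\<forall>m\<in>V. S m = range (\<lambda>y. \<Sum>i\<in>J. real_scale A (y i) (g i m))" by blast
  obtain b where b: "bij_betw b {..<k} J"
    using ex_bij_betw_nat_finite[OF g(1)] g(2) by (auto simp: atLeast0LessThan)
  have J: "(\<Sum>i\<in>J. real_scale A (y i) (g i m)) = (\<Sum>i<k. real_scale A (y (b i)) (g (b i) m))" for y m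
    by (rule sum.reindex_bij_betw[OF b, symmetric])
  \<comment> \<open>The rest of the proof renumbers the index set \<open>J\<close> by the first \<open>k\<close> natural numbers.\<close>
  define c where "c = inv_into {..<k} b"
  have c: "c (b i) = i" if "i < k" for i
    using that b unfolding c_def bij_betw_def by simp
  have re: "(\<Sum>i<k. real_scale A (y i) (g (b i) m)) = (\<Sum>i\<in>J. real_scale A (y (c i)) (g i m))" for y m
    unfolding J by (rule sum.cong) (auto simp: c)
  show thesis
  proof (rule that[of V "\<lambda>i. g (b i)"])
    show "\<forall>i<k. g (b i) \<in> sections \<A> A V"
      using g(5) bij_betwE[OF b] by simp
    have "R.independent_family {..<k} (\<lambda>i. g (b i) m)" if m: "m \<in> V" for m
      unfolding R.independent_family_def re
    proof (intro allI impI ballI)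
      fix y i assume "(\<Sum>i\<in>J. real_scale A (y (c i)) (g i m)) = 0" and i: "i \<in> {..<k}"
      then have "\<forall>j\<in>J. y (c j) = 0"
        using bspec[OF g(6) m, unfolded R.independent_family_def, rule_format, of "\<lambda>i. y (c i)"] by blast
      then have "y (c (b i)) = 0"
        using i bij_betwE[OF b] by blast
      then show "y i = 0"
        using i c by simp
    qed
    then show "\<forall>m\<in>V. R.independent_family {..<k} (\<lambda>i. g (b i) m)" by blast
    have "S m = range (\<lambda>y. \<Sum>i<k. real_scale A (y i) (g (b i) m))" if m: "m \<in> V" for m
    proof (intro equalityI subsetI)
      fix a assume "a \<in> S m"
      then obtain y where "a = (\<Sum>i\<in>J. real_scale A (y i) (g i m))"
        using g(7) m by blast
      then show "a \<in> range (\<lambda>y. \<Sum>i<k. real_scale A (y i) (g (b i) m))"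
        unfolding J by (rule image_eqI[where x = "\<lambda>i. y (b i)"]) simp
    next
      fix a assume "a \<in> range (\<lambda>y. \<Sum>i<k. real_scale A (y i) (g (b i) m))"
      then obtain y where "a = (\<Sum>i\<in>J. real_scale A (y (c i)) (g i m))"
        unfolding re by blast
      then show "a \<in> S m"
        using g(7) m by (auto intro: image_eqI[where x = "\<lambda>i. y (c i)"])
    qed
    then show "\<forall>m\<in>V. S m = range (\<lambda>y. \<Sum>i<k. real_scale A (y i) (g (b i) m))" by blast
  qed (rule g)+
qed

lemma fiber_subbundle: "fiber (real_subbundle \<A> A S k) = S"
  and rank_subbundle: "bundle_rank (real_subbundle \<A> A S k) = k"
  and scale_subbundle: "scale (real_subbundle \<A> A S k) = real_scale A"
  by (simp_all add: real_subbundle_def)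

lemma trivs_subbundle:
  "(U, \<tau>) \<in> trivs (real_subbundle \<A> A S k) \<longleftrightarrow>
     open U \<and> (\<forall>m\<in>U. fiberwise_iso (real_scale A) (S m) k (\<tau> m)) \<and>
     (\<forall>x\<in>coord_space k. (\<lambda>m. inv_into (S m) (\<tau> m) x) \<in> sections \<A> A U)"
  by (simp add: real_subbundle_def)

lemma subbundle_triv_section:
  "(U, \<tau>) \<in> trivs (real_subbundle \<A> A S k) \<Longrightarrow> x \<in> coord_space k
    \<Longrightarrow> (\<lambda>m. inv_into (S m) (\<tau> m) x) \<in> sections \<A> A U"
  by (simp add: trivs_subbundle)

lemma subbundle_expansion:
  assumes "(U, \<tau>) \<in> trivs (real_subbundle \<A> A S k)" "m \<in> U"
  shows "a \<in> S m \<Longrightarrow> a = (\<Sum>i<k. real_scale A (\<tau> m a i) (inv_into (S m) (\<tau> m) (unit_coord i)))"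
    and "R.independent_family {..<k} (\<lambda>i. inv_into (S m) (\<tau> m) (unit_coord i))"
proof -
  have "fiberwise_iso (real_scale A) (S m) k (\<tau> m)"
    using assms by (simp add: trivs_subbundle)
  note exp = fiberwise_iso_expansion[OF R.linear_elimination_axioms subspace this]
  show "a \<in> S m \<Longrightarrow> a = (\<Sum>i<k. real_scale A (\<tau> m a i) (inv_into (S m) (\<tau> m) (unit_coord i)))"
    by (rule exp(1))
  show "R.independent_family {..<k} (\<lambda>i. inv_into (S m) (\<tau> m) (unit_coord i))"
    by (rule exp(2))
qed

text \<open>The trivializations are only required to have smooth frames. That their coordinates are
  smooth is the smoothness of coefficients with respect to the frame, and it yields
  both the smooth transition functions and the description of the smooth sections.\<close>

lemma coordinate_smooth:
  assumes "(U, \<tau>) \<in> trivs (real_subbundle \<A> A S k)" "open W" "W \<subseteq> U"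
    and "s \<in> sections \<A> A W" "\<And>m. m \<in> W \<Longrightarrow> s m \<in> S m" "i < k"
  shows "smooth_fun \<A> W (\<lambda>m. \<tau> m (s m) i)"
proof (rule smooth_coefficients[where I = "{..<k}" and s = s and x = "\<lambda>i m. \<tau> m (s m) i"
      and e = "\<lambda>i m. inv_into (S m) (\<tau> m) (unit_coord i)"])
  show "(\<lambda>m. inv_into (S m) (\<tau> m) (unit_coord i)) \<in> sections \<A> A W" if "i \<in> {..<k}" for i
  proof (rule sections_subset[OF _ assms(3)])
    show "(\<lambda>m. inv_into (S m) (\<tau> m) (unit_coord i)) \<in> sections \<A> A U"
      using that by (intro subbundle_triv_section[OF assms(1)] unit_coord_space) simp
  qed
  fix m assume m: "m \<in> W"
  then have "m \<in> U" using assms(3) by blast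
  note exp = subbundle_expansion[OF assms(1) this]
  show "R.independent_family {..<k} (\<lambda>i. inv_into (S m) (\<tau> m) (unit_coord i))"
    by (rule exp(2))
  show "s m = (\<Sum>i<k. real_scale A (\<tau> m (s m) i) (inv_into (S m) (\<tau> m) (unit_coord i)))"
    by (rule exp(1)[OF assms(5)[OF m]])
qed (use assms in auto)

lemma subbundle_triv_near:
  obtains U \<tau> where "(U, \<tau>) \<in> trivs (real_subbundle \<A> A S k)" "p \<in> U"
proof -
  obtain e V where V: "open V" "p \<in> V" "\<forall>i<k. e i \<in> sections \<A> A V"
    "\<forall>m\<in>V. R.independent_family {..<k} (\<lambda>i. e i m)"
    "\<forall>m\<in>V. S m = range (\<lambda>y. \<Sum>i<k. real_scale A (y i) (e i m))"
    by (rule basis_near)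
  define \<tau> where "\<tau> m = inv_into (coord_space k) (\<lambda>y. \<Sum>i<k. real_scale A (y i) (e i m))" for m
  note basis = fiberwise_iso_of_basis[OF R.linear_elimination_axioms subspace V(4)[rule_format] V(5)[rule_format], folded \<tau>_def]
  have "(V, \<tau>) \<in> trivs (real_subbundle \<A> A S k)"
    unfolding trivs_subbundle
  proof (intro conjI ballI V(1) basis(1))
    fix x :: "nat \<Rightarrow> real" assume x: "x \<in> coord_space k"
    show "(\<lambda>m. inv_into (S m) (\<tau> m) x) \<in> sections \<A> A V"
    proof (rule sections_transform[OF _ V(1)])
      show "(\<lambda>m. \<Sum>i<k. real_scale A (x i) (e i m)) \<in> sections \<A> A V"
        using V(3) by (intro sections_combination V(1) smooth_fun_const) auto
      show "(\<Sum>i<k. real_scale A (x i) (e i m)) = inv_into (S m) (\<tau> m) x" if "m \<in> V" for m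
        by (rule basis(2)[OF that that x, symmetric])
    qed
  qed
  from this V(2) show thesis by (rule that)
qed

theorem vector_bundle_subbundle: "vector_bundle \<A> (real_subbundle \<A> A S k)"
  unfolding vector_bundle_def fiber_subbundle rank_subbundle scale_subbundle
proof (intro conjI allI ballI)
  show "vector_space (real_scale A)" by (rule R.vector_space_axioms)
  show "R.subspace (S m)" for m by (rule subspace)
  have "p \<in> (\<Union>(U, \<tau>)\<in>trivs (real_subbundle \<A> A S k). U)" for p
  proof -
    obtain U \<tau> where "(U, \<tau>) \<in> trivs (real_subbundle \<A> A S k)" "p \<in> U"
      by (rule subbundle_triv_near)
    then show ?thesis by blast
  qed
  then show "(\<Union>(U, \<tau>)\<in>trivs (real_subbundle \<A> A S k). U) = UNIV" by blast
next
  fix u assume "u \<in> trivs (real_subbundle \<A> A S k)"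
  then show "case u of (U, \<tau>) \<Rightarrow> open U \<and> (\<forall>m\<in>U. fiberwise_iso (real_scale A) (S m) k (\<tau> m))"
    by (cases u) (simp add: trivs_subbundle)
next
  fix u assume u: "u \<in> trivs (real_subbundle \<A> A S k)"
  obtain U \<tau> where [simp]: "u = (U, \<tau>)" by (cases u)
  have U: "open U" "\<And>m. m \<in> U \<Longrightarrow> fiberwise_iso (real_scale A) (S m) k (\<tau> m)"
      "\<And>x. x \<in> coord_space k \<Longrightarrow> (\<lambda>m. inv_into (S m) (\<tau> m) x) \<in> sections \<A> A U"
    using u by (simp_all add: trivs_subbundle)
  have "smooth_fun \<A> (U \<inter> V) (\<lambda>m. \<sigma> m (inv_into (S m) (\<tau> m) x) i)"
    if V: "(V, \<sigma>) \<in> trivs (real_subbundle \<A> A S k)" and x: "x \<in> coord_space k" and i: "i < k"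
    for V \<sigma> x i
  proof (rule coordinate_smooth[OF V _ _ _ _ i])
    show "open (U \<inter> V)" using U(1) V by (auto simp: trivs_subbundle)
    show "(\<lambda>m. inv_into (S m) (\<tau> m) x) \<in> sections \<A> A (U \<inter> V)"
      by (rule sections_subset[OF U(3)[OF x]]) simp
    show "inv_into (S m) (\<tau> m) x \<in> S m" if "m \<in> U \<inter> V" for m
      using fiberwise_iso_inv_into(1)[OF U(2) x] that by blast
  qed simp
  then show "case u of (U, \<tau>) \<Rightarrow> \<forall>(V, \<sigma>)\<in>trivs (real_subbundle \<A> A S k). \<forall>x\<in>coord_space k. \<forall>i<k.
      smooth_fun \<A> (U \<inter> V) (\<lambda>m. \<sigma> m (inv_into (S m) (\<tau> m) x) i)"
    by auto
qed

text \<open>The coordinates of a section are smooth iff the section is smooth in \<open>A\<close>: one direction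
  is \<open>coordinate_smooth\<close>, the other expands the section in a local frame.\<close>

lemma sections_subbundle:
  assumes "open W"
  shows "s \<in> sections \<A> (real_subbundle \<A> A S k) W \<longleftrightarrow> s \<in> sections \<A> A W \<and> (\<forall>m\<in>W. s m \<in> S m)"
proof
  assume "s \<in> sections \<A> A W \<and> (\<forall>m\<in>W. s m \<in> S m)"
  then have s: "s \<in> sections \<A> A W" "\<And>m. m \<in> W \<Longrightarrow> s m \<in> S m" by auto
  have "smooth_fun \<A> (W \<inter> U) (\<lambda>m. \<tau> m (s m) i)"
    if U: "(U, \<tau>) \<in> trivs (real_subbundle \<A> A S k)" and i: "i < k" for U \<tau> i
    using U s assms sections_subset[OF s(1), of "W \<inter> U"]
    by (intro coordinate_smooth[OF U _ _ _ _ i]) (auto simp: trivs_subbundle)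
  with s show "s \<in> sections \<A> (real_subbundle \<A> A S k) W"
    unfolding sections_def fiber_subbundle rank_subbundle by auto
next
  assume s: "s \<in> sections \<A> (real_subbundle \<A> A S k) W"
  have sS: "s m \<in> S m" if "m \<in> W" for m
    using s that by (simp add: sections_def fiber_subbundle)
  have "s \<in> sections \<A> A W"
  proof (rule sections_local)
    fix p assume p: "p \<in> W"
    obtain U \<tau> where U: "(U, \<tau>) \<in> trivs (real_subbundle \<A> A S k)" "p \<in> U"
      by (rule subbundle_triv_near)
    have op: "open (W \<inter> U)" using assms U by (auto simp: trivs_subbundle)
    let ?e = "\<lambda>i m. inv_into (S m) (\<tau> m) (unit_coord i)"
    have e: "?e i \<in> sections \<A> A (W \<inter> U)" if "i < k" for i
    proof (rule sections_subset)
      show "?e i \<in> sections \<A> A U"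
        using that by (intro subbundle_triv_section[OF U(1)] unit_coord_space)
    qed simp
    have x: "smooth_fun \<A> (W \<inter> U) (\<lambda>m. \<tau> m (s m) i)" if "i < k" for i
      using s U(1) that unfolding sections_def rank_subbundle by auto
    have "s \<in> sections \<A> A (W \<inter> U)"
    proof (rule sections_transform[OF _ op])
      show "(\<lambda>m. \<Sum>i<k. real_scale A (\<tau> m (s m) i) (?e i m)) \<in> sections \<A> A (W \<inter> U)"
        using e x by (intro sections_combination op) auto
      show "(\<Sum>i<k. real_scale A (\<tau> m (s m) i) (?e i m)) = s m" if "m \<in> W \<inter> U" for m
        using subbundle_expansion(1)[OF U(1) _ sS] that by simp
    qed
    with op p U(2) show "\<exists>V. open V \<and> p \<in> V \<and> s \<in> sections \<A> A V" by blast
  qed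
  with sS show "s \<in> sections \<A> A W \<and> (\<forall>m\<in>W. s m \<in> S m)" by blast
qed

end

lemma (in complex_bundle) dim_scale_image:
  assumes "R.subspace S" "u \<noteq> 0"
  shows "R.dim (scale A u ` S) = R.dim S"
proof -
  interpret L: Vector_Spaces.linear "real_scale A" "real_scale A" "scale A u"
    by unfold_locales (simp_all add: real_scale_def C.scale_right_distrib mult.commute)
  obtain B where B: "B \<subseteq> S" "R.independent B" "S \<subseteq> R.span B" "card B = R.dim S"
    using R.basis_exists by blast
  have inj: "inj_on (scale A u) T" for T
    using assms(2) by (auto intro: inj_onI)
  show ?thesis
  proof (rule R.dim_unique)
    show "scale A u ` B \<subseteq> scale A u ` S" using B(1) by blast
    show "scale A u ` S \<subseteq> R.span (scale A u ` B)"
      unfolding L.span_image using B(3) by blast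
    show "R.independent (scale A u ` B)"
      by (rule L.independent_injective_image[OF B(2) inj])
    show "card (scale A u ` B) = R.dim S"
      using card_image[OF inj] B(4) by metis
  qed
qed

text \<open>Multiplication by a constant preserves smooth sections of the ambient bundle, hence is smooth
  between any two subbundles. \<open>\<Phi>\<close> is prescribed only on the fibers, so that the inverse of such
  a multiplication, given as an \<open>inv_into\<close>, is covered as well.\<close>

lemma bundle_map_scale:
  assumes "constant_rank_family \<A> A S k" "constant_rank_family \<A> A S' k'"
    and "\<And>m a. a \<in> S m \<Longrightarrow> \<Phi> m a = scale A u a" "\<And>m a. a \<in> S m \<Longrightarrow> scale A u a \<in> S' m"
  shows "bundle_map \<A> (real_subbundle \<A> A S k) (real_subbundle \<A> A S' k') \<Phi>"
proof -
  interpret S: constant_rank_family \<A> A S k by fact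
  interpret S': constant_rank_family \<A> A S' k' by fact
  show ?thesis
    unfolding bundle_map_def S.fiber_subbundle S'.fiber_subbundle S.rank_subbundle S'.rank_subbundle
      S.scale_subbundle S'.scale_subbundle
  proof (intro conjI allI ballI)
    fix m a assume a: "a \<in> S m"
    show "\<Phi> m a \<in> S' m" using assms(3,4) a by simp
    show "\<Phi> m (a + b) = \<Phi> m a + \<Phi> m b" if "b \<in> S m" for b
      using assms(3) a that S.R.subspace_add[OF S.subspace a that] by (simp add: S.C.scale_right_distrib)
    show "\<Phi> m (real_scale A z a) = real_scale A z (\<Phi> m a)" for z
      using assms(3) a S.R.subspace_scale[OF S.subspace a] by (simp add: real_scale_def mult.commute)
  next
    fix w assume w: "w \<in> trivs (real_subbundle \<A> A S k)"
    obtain U \<tau> where [simp]: "w = (U, \<tau>)" by (cases w)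
    have U: "open U" "\<And>m. m \<in> U \<Longrightarrow> fiberwise_iso (real_scale A) (S m) k (\<tau> m)"
        "\<And>x. x \<in> coord_space k \<Longrightarrow> (\<lambda>m. inv_into (S m) (\<tau> m) x) \<in> sections \<A> A U"
      using w by (simp_all add: S.trivs_subbundle)
    have "smooth_fun \<A> (U \<inter> V) (\<lambda>m. \<sigma> m (\<Phi> m (inv_into (S m) (\<tau> m) x)) i)"
      if V: "(V, \<sigma>) \<in> trivs (real_subbundle \<A> A S' k')" and x: "x \<in> coord_space k" and i: "i < k'"
      for V \<sigma> x i
    proof -
      have op: "open (U \<inter> V)" using U(1) V by (auto simp: S'.trivs_subbundle)
      have xS: "inv_into (S m) (\<tau> m) x \<in> S m" if "m \<in> U \<inter> V" for m
        using fiberwise_iso_inv_into(1)[OF U(2) x] that by blast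
      have "smooth_fun \<A> (U \<inter> V) (\<lambda>m. \<sigma> m (scale A u (inv_into (S m) (\<tau> m) x)) i)"
        using xS assms(4)
        by (intro S'.coordinate_smooth[OF V op _ _ _ i]
            S.sections_scale[OF op S.smooth_fun_const] S.sections_subset[OF U(3)[OF x]]) auto
      then show ?thesis
        by (rule S.smooth_fun_transform[OF _ op]) (simp add: assms(3) xS)
    qed
    then show "case w of (U, \<tau>) \<Rightarrow> \<forall>(V, \<sigma>)\<in>trivs (real_subbundle \<A> A S' k'). \<forall>x\<in>coord_space k.
        \<forall>i<k'. smooth_fun \<A> (U \<inter> V) (\<lambda>m. \<sigma> m (\<Phi> m (inv_into (S m) (\<tau> m) x)) i)"
      by auto
  qed
qed

section \<open>Derivatives along tangent vectors and brackets of vector fields\<close>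

lemma frechet_derivative_minus:
  assumes "f differentiable (at x)"
  shows "frechet_derivative (\<lambda>y. - f y) (at x) = (\<lambda>v. - frechet_derivative f (at x) v)"
  using has_derivative_minus[OF assms[unfolded frechet_derivative_works]] frechet_derivative_at by metis

lemma frechet_derivative_zero:
  "f differentiable (at x) \<Longrightarrow> frechet_derivative f (at x) 0 = 0"
  using linear_0[OF linear_frechet_derivative] .

lemma frechet_derivative_neg:
  "f differentiable (at x) \<Longrightarrow> frechet_derivative f (at x) (- v) = - frechet_derivative f (at x) v"
  using linear_neg[OF linear_frechet_derivative] .

context manifold
begin

text \<open>The bracket is the difference of two Frechet derivatives, which are linear in the field and
  in the direction only where the field is differentiable.\<close>

definition smooth_field :: "('m \<Rightarrow> ('m, 'e) tvec) \<Rightarrow> bool" where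
  "smooth_field X \<longleftrightarrow> (\<forall>c\<in>\<A>. smooth_fun \<A> (fst c) (\<lambda>m. X m c))"

lemma smooth_field_differentiable:
  assumes "smooth_field X" "c \<in> \<A>" "p \<in> fst c"
  shows "((\<lambda>q. X q c) \<circ> cinv c) differentiable (at (snd c p))"
  using assms unfolding smooth_field_def by (intro smooth_fun_differentiable[of "fst c"]) auto

lemma smooth_field_minus: "smooth_field X \<Longrightarrow> smooth_field (\<lambda>m. - X m)"
  by (simp add: smooth_field_def smooth_fun_minus open_chart)

lemma vf_bracket_zero:
  assumes "smooth_field X"
  shows "vf_bracket \<A> X (\<lambda>m. 0) = (\<lambda>m. 0)" "vf_bracket \<A> (\<lambda>m. 0) X = (\<lambda>m. 0)"
  using smooth_field_differentiable[OF assms]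
  by (auto simp: vf_bracket_def fun_eq_iff frechet_derivative_zero comp_def)

lemma vf_bracket_minus:
  assumes "smooth_field X" "smooth_field Y"
  shows "vf_bracket \<A> (\<lambda>m. - X m) Y = (\<lambda>m. - vf_bracket \<A> X Y m)"
    and "vf_bracket \<A> X (\<lambda>m. - Y m) = (\<lambda>m. - vf_bracket \<A> X Y m)"
proof -
  have "vf_bracket \<A> (\<lambda>m. - X m) Y p c = - vf_bracket \<A> X Y p c \<and>
      vf_bracket \<A> X (\<lambda>m. - Y m) p c = - vf_bracket \<A> X Y p c" for p c
  proof (cases "c \<in> \<A> \<and> p \<in> fst c")
    case True
    then have d: "((\<lambda>q. X q c) \<circ> cinv c) differentiable (at (snd c p))"
        "((\<lambda>q. Y q c) \<circ> cinv c) differentiable (at (snd c p))"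
      using smooth_field_differentiable assms by auto
    note m = d[THEN frechet_derivative_minus] d[THEN frechet_derivative_neg]
    show ?thesis
      using True m by (simp add: vf_bracket_def comp_def)
  qed (auto simp: vf_bracket_def)
  then show "vf_bracket \<A> (\<lambda>m. - X m) Y = (\<lambda>m. - vf_bracket \<A> X Y m)"
    "vf_bracket \<A> X (\<lambda>m. - Y m) = (\<lambda>m. - vf_bracket \<A> X Y m)"
    by (simp_all add: fun_eq_iff)
qed

lemma chosen_chart:
  "(SOME c. c \<in> \<A> \<and> p \<in> fst c) \<in> \<A>" "p \<in> fst (SOME c. c \<in> \<A> \<and> p \<in> fst c)"
proof -
  obtain c where "c \<in> \<A> \<and> p \<in> fst c" using chart_around by blast
  from someI[of "\<lambda>c. c \<in> \<A> \<and> p \<in> fst c", OF this]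
  show "(SOME c. c \<in> \<A> \<and> p \<in> fst c) \<in> \<A>" "p \<in> fst (SOME c. c \<in> \<A> \<and> p \<in> fst c)" by auto
qed

lemma chosen_chart_differentiable:
  assumes "smooth_fun \<A> UNIV f"
  shows "(f \<circ> cinv (SOME c. c \<in> \<A> \<and> p \<in> fst c)) differentiable (at (snd (SOME c. c \<in> \<A> \<and> p \<in> fst c) p))"
  by (rule smooth_fun_differentiable[OF assms UNIV_I chosen_chart])

lemma tderiv_zero: "smooth_fun \<A> UNIV f \<Longrightarrow> tderiv \<A> p 0 f = 0"
  by (simp add: tderiv_def Let_def frechet_derivative_zero chosen_chart_differentiable)

lemma tderiv_minus: "smooth_fun \<A> UNIV f \<Longrightarrow> tderiv \<A> p (- v) f = - tderiv \<A> p v f"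
  by (simp add: tderiv_def Let_def frechet_derivative_neg chosen_chart_differentiable)

lemma tderiv_linear:
  assumes "bounded_linear h" "smooth_fun \<A> UNIV f"
  shows "tderiv \<A> p v (\<lambda>m. h (f m)) = h (tderiv \<A> p v f)"
proof -
  let ?c = "SOME c. c \<in> \<A> \<and> p \<in> fst c"
  have "((\<lambda>x. h ((f \<circ> cinv ?c) x)) has_derivative
      (\<lambda>w. h (frechet_derivative (f \<circ> cinv ?c) (at (snd ?c p)) w))) (at (snd ?c p))"
    by (rule bounded_linear.has_derivative[OF assms(1)
          chosen_chart_differentiable[OF assms(2), unfolded frechet_derivative_works]])
  from frechet_derivative_at[OF this] show ?thesis
    by (simp add: tderiv_def Let_def comp_def fun_eq_iff)
qed

text \<open>The representatives of a tangent vector correspond to each other under linear maps, so it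
  vanishes if one of them does. Thus one chart suffices to detect whether \<open>anchor2\<close> is zero.\<close>

lemma tangent_space_eq_0:
  assumes "v \<in> tangent_space \<A> p" "c \<in> \<A>" "p \<in> fst c" "v c = 0"
  shows "v = 0"
proof
  have change: "\<forall>c\<in>\<A>. \<forall>c'\<in>\<A>. p \<in> fst c \<longrightarrow> p \<in> fst c' \<longrightarrow>
        v c' = frechet_derivative (snd c' \<circ> cinv c) (at (snd c p)) (v c)"
    and outside: "\<forall>c. c \<notin> \<A> \<or> p \<notin> fst c \<longrightarrow> v c = 0"
    using assms(1) unfolding tangent_space_def mem_Collect_eq by (rule conjunct1, rule conjunct2)
  fix c'
  show "v c' = 0 c'"
  proof (cases "c' \<in> \<A> \<and> p \<in> fst c'")
    case True
    have "smooth_on (snd c ` (fst c \<inter> fst c')) (snd c' \<circ> cinv c)"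
      using smooth_manifold assms(2) True by (simp add: smooth_manifold_def)
    then have "Ck_on (Suc 0) (snd c ` (fst c \<inter> fst c')) (snd c' \<circ> cinv c)"
      by (simp only: smooth_on_def)
    then have "(snd c' \<circ> cinv c) differentiable (at (snd c p))"
      using True assms(3) by auto
    moreover have "v c' = frechet_derivative (snd c' \<circ> cinv c) (at (snd c p)) (v c)"
      using change assms(2,3) True by blast
    ultimately show ?thesis
      using assms(4) by (simp add: frechet_derivative_zero)
  next
    case False
    then have "v c' = 0" using outside by blast
    then show ?thesis by simp
  qed
qed

end

section \<open>Complex Lie algebroids\<close>

lemma ctscale_of_real: "ctscale (of_real r) u = (tscale r (fst u), tscale r (snd u))"
  and ctscale_i: "ctscale \<i> u = (- snd u, fst u)"
  and ctscale_ctscale: "ctscale z (ctscale w u) = ctscale (z * w) u"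
  by (auto simp: ctscale_def tscale_def fun_eq_iff algebra_simps prod_eq_iff)

lemma tscale_zero: "tscale r 0 = 0"
  by (simp add: tscale_def fun_eq_iff)

lemma ctscale_add: "ctscale z (u + w) = ctscale z u + ctscale z w"
  by (auto simp: ctscale_def tscale_def fun_eq_iff algebra_simps prod_eq_iff)

locale complex_algebroid = manifold \<A>
  for \<A> :: "('m::{t2_space,second_countable_topology}, 'e::real_inner) chart set" +
  fixes A :: "('m, 'v::ab_group_add, complex) vbundle"
    and br :: "('m \<Rightarrow> 'v) \<Rightarrow> ('m \<Rightarrow> 'v) \<Rightarrow> 'm \<Rightarrow> 'v"
    and \<rho> :: "'m \<Rightarrow> 'v \<Rightarrow> ('m, 'e) ctvec"
  assumes algebroid: "complex_lie_algebroid \<A> A br \<rho>"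
begin

sublocale complex_bundle \<A> A
  by unfold_locales (use algebroid in \<open>simp add: complex_lie_algebroid_def\<close>)

abbreviation "\<Gamma> \<equiv> sections \<A> A UNIV"

lemma lie_bracket: "lie_bracket_on_sections \<A> A br"
  using algebroid by (simp add: complex_lie_algebroid_def)

lemma bracket_section: "\<alpha> \<in> \<Gamma> \<Longrightarrow> \<beta> \<in> \<Gamma> \<Longrightarrow> br \<alpha> \<beta> \<in> \<Gamma>"
  and bracket_add_left: "\<alpha> \<in> \<Gamma> \<Longrightarrow> \<beta> \<in> \<Gamma> \<Longrightarrow> \<gamma> \<in> \<Gamma> \<Longrightarrow> br (\<alpha> + \<beta>) \<gamma> = br \<alpha> \<gamma> + br \<beta> \<gamma>"
  and bracket_add_right: "\<alpha> \<in> \<Gamma> \<Longrightarrow> \<beta> \<in> \<Gamma> \<Longrightarrow> \<gamma> \<in> \<Gamma> \<Longrightarrow> br \<gamma> (\<alpha> + \<beta>) = br \<gamma> \<alpha> + br \<gamma> \<beta>"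
  and bracket_scale_left:
    "\<alpha> \<in> \<Gamma> \<Longrightarrow> \<beta> \<in> \<Gamma> \<Longrightarrow> br (\<lambda>m. scale A z (\<alpha> m)) \<beta> = (\<lambda>m. scale A z (br \<alpha> \<beta> m))"
  and bracket_scale_right:
    "\<alpha> \<in> \<Gamma> \<Longrightarrow> \<beta> \<in> \<Gamma> \<Longrightarrow> br \<alpha> (\<lambda>m. scale A z (\<beta> m)) = (\<lambda>m. scale A z (br \<alpha> \<beta> m))"
  and bracket_self: "\<alpha> \<in> \<Gamma> \<Longrightarrow> br \<alpha> \<alpha> = 0"
  and jacobi: "\<alpha> \<in> \<Gamma> \<Longrightarrow> \<beta> \<in> \<Gamma> \<Longrightarrow> \<gamma> \<in> \<Gamma>
    \<Longrightarrow> br \<alpha> (br \<beta> \<gamma>) + br \<beta> (br \<gamma> \<alpha>) + br \<gamma> (br \<alpha> \<beta>) = 0"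
  using lie_bracket by (simp_all add: lie_bracket_on_sections_def Let_def)

lemma anchor_tangent: "a \<in> fiber A m \<Longrightarrow> \<rho> m a \<in> ctangent_space \<A> m"
  and anchor_add: "a \<in> fiber A m \<Longrightarrow> b \<in> fiber A m \<Longrightarrow> \<rho> m (a + b) = \<rho> m a + \<rho> m b"
  and anchor_scale: "a \<in> fiber A m \<Longrightarrow> \<rho> m (scale A z a) = ctscale z (\<rho> m a)"
  and anchor_bracket: "\<alpha> \<in> \<Gamma> \<Longrightarrow> \<beta> \<in> \<Gamma>
    \<Longrightarrow> (\<lambda>m. \<rho> m (br \<alpha> \<beta> m)) = cvf_bracket \<A> (\<lambda>m. \<rho> m (\<alpha> m)) (\<lambda>m. \<rho> m (\<beta> m))"
  and leibniz: "\<alpha> \<in> \<Gamma> \<Longrightarrow> \<beta> \<in> \<Gamma> \<Longrightarrow> smooth_fun \<A> UNIV f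
    \<Longrightarrow> br \<alpha> (\<lambda>m. scale A (f m) (\<beta> m)) =
        (\<lambda>m. scale A (f m) (br \<alpha> \<beta> m) + scale A (ctderiv \<A> m (\<rho> m (\<alpha> m)) f) (\<beta> m))"
  using algebroid by (simp_all add: complex_lie_algebroid_def)

lemma anchor_smooth:
  assumes "(U, \<tau>) \<in> trivs A" "c \<in> \<A>" "x \<in> coord_space (bundle_rank A)"
  shows "smooth_fun \<A> (U \<inter> fst c) (\<lambda>m. fst (\<rho> m (inv_into (fiber A m) (\<tau> m) x)) c)"
    and "smooth_fun \<A> (U \<inter> fst c) (\<lambda>m. snd (\<rho> m (inv_into (fiber A m) (\<tau> m) x)) c)"
proof -
  have "\<forall>(U, \<tau>)\<in>trivs A. \<forall>c\<in>\<A>. \<forall>x\<in>coord_space (bundle_rank A).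
        smooth_fun \<A> (U \<inter> fst c) (\<lambda>m. fst (\<rho> m (inv_into (fiber A m) (\<tau> m) x)) c) \<and>
        smooth_fun \<A> (U \<inter> fst c) (\<lambda>m. snd (\<rho> m (inv_into (fiber A m) (\<tau> m) x)) c)"
    using algebroid unfolding complex_lie_algebroid_def by (elim conjE)
  from bspec[OF this assms(1)] assms(2,3)
  show "smooth_fun \<A> (U \<inter> fst c) (\<lambda>m. fst (\<rho> m (inv_into (fiber A m) (\<tau> m) x)) c)"
    "smooth_fun \<A> (U \<inter> fst c) (\<lambda>m. snd (\<rho> m (inv_into (fiber A m) (\<tau> m) x)) c)" by auto
qed

lemma anchor_zero: "\<rho> m 0 = 0"
  using anchor_scale[OF C.subspace_0[OF subspace_fiber], of m 0]
  by (simp add: ctscale_def tscale_def zero_prod_def zero_fun_def)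

lemma fst_anchor_combination:
  assumes "\<And>i. i \<in> I \<Longrightarrow> f i \<in> fiber A m"
  shows "fst (\<rho> m (\<Sum>i\<in>I. scale A (z i) (f i))) c =
    (\<Sum>i\<in>I. Re (z i) *\<^sub>R fst (\<rho> m (f i)) c - Im (z i) *\<^sub>R snd (\<rho> m (f i)) c)"
  using assms
proof (induction I rule: infinite_finite_induct)
  case (insert i I)
  have "(\<Sum>i\<in>I. scale A (z i) (f i)) \<in> fiber A m"
    using insert.prems by (intro C.subspace_combination[OF subspace_fiber]) auto
  with insert show ?case
    by (simp add: anchor_add anchor_scale scale_fiber) (simp add: ctscale_def tscale_def)
qed (simp_all add: anchor_zero)

text \<open>The anchor is smooth on local frames; expanding a section in such a frame extends this to
  all smooth sections.\<close>

lemma anchor_section_smooth: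
  assumes "open W" "s \<in> sections \<A> A W" "c \<in> \<A>"
  shows "smooth_fun \<A> (W \<inter> fst c) (\<lambda>m. fst (\<rho> m (s m)) c)"
    and "smooth_fun \<A> (W \<inter> fst c) (\<lambda>m. snd (\<rho> m (s m)) c)"
proof -
  have fst: "smooth_fun \<A> (W \<inter> fst c) (\<lambda>m. fst (\<rho> m (s m)) c)" if s: "s \<in> sections \<A> A W" for s
  proof (rule smooth_fun_local)
    fix p assume p: "p \<in> W \<inter> fst c"
    obtain U \<tau> where U: "(U, \<tau>) \<in> trivs A" "p \<in> U" by (rule trivs_cover)
    let ?X = "W \<inter> U \<inter> fst c"
    have op: "open ?X" using assms(1,3) open_triv[OF U(1)] open_chart by blast
    have "smooth_fun \<A> ?X (\<lambda>m. \<Sum>i<bundle_rank A. Re (\<tau> m (s m) i) *\<^sub>R fst (\<rho> m (triv_frame \<tau> i m)) c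
        - Im (\<tau> m (s m) i) *\<^sub>R snd (\<rho> m (triv_frame \<tau> i m)) c)"
    proof (intro smooth_fun_sum smooth_fun_diff smooth_fun_scaleR op)
      fix i assume i: "i \<in> {..<bundle_rank A}"
      have "smooth_fun \<A> (W \<inter> U) (\<lambda>m. \<tau> m (s m) i)"
        using s U(1) i unfolding sections_iff by auto
      then have x: "smooth_fun \<A> ?X (\<lambda>m. \<tau> m (s m) i)"
        by (rule smooth_fun_subset) blast
      show "smooth_fun \<A> ?X (\<lambda>m. Re (\<tau> m (s m) i))" "smooth_fun \<A> ?X (\<lambda>m. Im (\<tau> m (s m) i))"
        using smooth_fun_linear[OF bounded_linear_Re op x] smooth_fun_linear[OF bounded_linear_Im op x] .
      have u: "unit_coord i \<in> coord_space (bundle_rank A)"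
        using i by (simp add: unit_coord_space)
      show "smooth_fun \<A> ?X (\<lambda>m. fst (\<rho> m (triv_frame \<tau> i m)) c)"
        "smooth_fun \<A> ?X (\<lambda>m. snd (\<rho> m (triv_frame \<tau> i m)) c)"
        unfolding triv_frame_def
        by (rule smooth_fun_subset[OF anchor_smooth(1)[OF U(1) assms(3) u]], blast)
          (rule smooth_fun_subset[OF anchor_smooth(2)[OF U(1) assms(3) u]], blast)
    qed
    then have "smooth_fun \<A> ?X (\<lambda>m. fst (\<rho> m (s m)) c)"
    proof (rule smooth_fun_transform[OF _ op])
      fix m assume m: "m \<in> ?X"
      have e: "triv_frame \<tau> i m \<in> fiber A m" if "i \<in> {..<bundle_rank A}" for i
        using sections_fiber[OF triv_frame_section[OF U(1)]] that m by simp
      have sm: "s m = (\<Sum>i<bundle_rank A. scale A (\<tau> m (s m) i) (triv_frame \<tau> i m))"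
        using triv_frame_expansion[OF U(1)] sections_fiber[OF s] m by simp
      have "fst (\<rho> m (\<Sum>i<bundle_rank A. scale A (\<tau> m (s m) i) (triv_frame \<tau> i m))) c =
          (\<Sum>i<bundle_rank A. Re (\<tau> m (s m) i) *\<^sub>R fst (\<rho> m (triv_frame \<tau> i m)) c
          - Im (\<tau> m (s m) i) *\<^sub>R snd (\<rho> m (triv_frame \<tau> i m)) c)"
        using e by (rule fst_anchor_combination)
      then show "(\<Sum>i<bundle_rank A. Re (\<tau> m (s m) i) *\<^sub>R fst (\<rho> m (triv_frame \<tau> i m)) c
        - Im (\<tau> m (s m) i) *\<^sub>R snd (\<rho> m (triv_frame \<tau> i m)) c) = fst (\<rho> m (s m)) c"
        unfolding sm[symmetric] by (rule sym)
    qed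
    with op p U(2) show "\<exists>V. open V \<and> p \<in> V \<and> smooth_fun \<A> V (\<lambda>m. fst (\<rho> m (s m)) c)" by blast
  qed
  show "smooth_fun \<A> (W \<inter> fst c) (\<lambda>m. fst (\<rho> m (s m)) c)"
    by (rule fst[OF assms(2)])
  have op: "open (W \<inter> fst c)" using assms(1,3) open_chart by blast
  \<comment> \<open>The imaginary part of \<open>\<rho> (s)\<close> is the real part of \<open>\<rho> (- \<i> s)\<close>.\<close>
  show "smooth_fun \<A> (W \<inter> fst c) (\<lambda>m. snd (\<rho> m (s m)) c)"
  proof (rule smooth_fun_transform[OF _ op])
    show "smooth_fun \<A> (W \<inter> fst c) (\<lambda>m. fst (\<rho> m (scale A (- \<i>) (s m))) c)"
      by (rule fst[OF sections_scale[OF assms(1) smooth_fun_const assms(2)]])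
    fix m assume "m \<in> W \<inter> fst c"
    then have "s m \<in> fiber A m"
      using sections_fiber[OF assms(2)] by blast
    then show "fst (\<rho> m (scale A (- \<i>) (s m))) c = snd (\<rho> m (s m)) c"
      unfolding anchor_scale[OF \<open>s m \<in> fiber A m\<close>] by (simp add: ctscale_def tscale_def)
  qed
qed

lemma anchor_field:
  assumes "\<alpha> \<in> \<Gamma>"
  shows "smooth_field (\<lambda>m. fst (\<rho> m (\<alpha> m)))" "smooth_field (\<lambda>m. snd (\<rho> m (\<alpha> m)))"
  using anchor_section_smooth[OF open_UNIV assms] by (simp_all add: smooth_field_def)

text \<open>Each axiom is homogeneous in the pair of bracket and anchor. The real part of this
  algebroid is the family \<open>i_re_bundle\<close>, so that results on real parts apply to both
  algebroids of the theorem.\<close>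

theorem multiply_i: "complex_lie_algebroid \<A> A (i_bracket A br) (\<lambda>m a. ctscale \<i> (\<rho> m a))"
proof -
  note ib = i_bracket_def mult_i_def
  have sec: "i_bracket A br \<alpha> \<beta> \<in> \<Gamma>" if "\<alpha> \<in> \<Gamma>" "\<beta> \<in> \<Gamma>" for \<alpha> \<beta>
    unfolding ib using that by (intro sections_scale smooth_fun_const bracket_section) auto
  have twice: "i_bracket A br \<alpha> (i_bracket A br \<beta> \<gamma>) = - br \<alpha> (br \<beta> \<gamma>)"
    if "\<alpha> \<in> \<Gamma>" "\<beta> \<in> \<Gamma>" "\<gamma> \<in> \<Gamma>" for \<alpha> \<beta> \<gamma>
    unfolding ib bracket_scale_right[OF that(1) bracket_section[OF that(2,3)]] by (simp add: fun_eq_iff)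
  have "lie_bracket_on_sections \<A> A (i_bracket A br)"
    unfolding lie_bracket_on_sections_def Let_def
  proof (intro conjI ballI allI)
    fix \<alpha> \<beta> \<gamma> assume s: "\<alpha> \<in> \<Gamma>" "\<beta> \<in> \<Gamma>" "\<gamma> \<in> \<Gamma>"
    show "i_bracket A br (\<alpha> + \<beta>) \<gamma> = i_bracket A br \<alpha> \<gamma> + i_bracket A br \<beta> \<gamma>"
      "i_bracket A br \<gamma> (\<alpha> + \<beta>) = i_bracket A br \<gamma> \<alpha> + i_bracket A br \<gamma> \<beta>"
      using s by (simp_all add: ib bracket_add_left bracket_add_right C.scale_right_distrib fun_eq_iff)
    have "- (br \<alpha> (br \<beta> \<gamma>) + br \<beta> (br \<gamma> \<alpha>) + br \<gamma> (br \<alpha> \<beta>)) = 0"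
      unfolding jacobi[OF s] by simp
    then show "i_bracket A br \<alpha> (i_bracket A br \<beta> \<gamma>) + i_bracket A br \<beta> (i_bracket A br \<gamma> \<alpha>) +
        i_bracket A br \<gamma> (i_bracket A br \<alpha> \<beta>) = 0"
      using s by (simp add: twice)
  next
    fix \<alpha> \<beta> z assume s: "\<alpha> \<in> \<Gamma>" "\<beta> \<in> \<Gamma>"
    show "i_bracket A br (\<lambda>m. scale A z (\<alpha> m)) \<beta> = (\<lambda>m. scale A z (i_bracket A br \<alpha> \<beta> m))"
      "i_bracket A br \<alpha> (\<lambda>m. scale A z (\<beta> m)) = (\<lambda>m. scale A z (i_bracket A br \<alpha> \<beta> m))"
      using s by (simp_all add: ib bracket_scale_left bracket_scale_right mult.commute)
    show "i_bracket A br \<alpha> \<alpha> = 0"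
      using s by (simp add: ib bracket_self fun_eq_iff)
  qed (rule sec)
  moreover have "(\<lambda>m. ctscale \<i> (\<rho> m (i_bracket A br \<alpha> \<beta> m))) =
      cvf_bracket \<A> (\<lambda>m. ctscale \<i> (\<rho> m (\<alpha> m))) (\<lambda>m. ctscale \<i> (\<rho> m (\<beta> m)))"
    if s: "\<alpha> \<in> \<Gamma>" "\<beta> \<in> \<Gamma>" for \<alpha> \<beta>
  proof -
    have neg: "ctscale \<i> (\<rho> m (i_bracket A br \<alpha> \<beta> m)) = - \<rho> m (br \<alpha> \<beta> m)" for m
      using sections_fiber[OF bracket_section[OF s], of m] by (simp add: ib anchor_scale ctscale_i prod_eq_iff)
    have br: "\<rho> m (br \<alpha> \<beta> m) = cvf_bracket \<A> (\<lambda>m. \<rho> m (\<alpha> m)) (\<lambda>m. \<rho> m (\<beta> m)) m" for m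
      using anchor_bracket[OF s] by (rule fun_cong)
    show ?thesis
      unfolding neg br using anchor_field[OF s(1)] anchor_field[OF s(2)]
      by (simp add: cvf_bracket_def comp_def ctscale_i vf_bracket_minus smooth_field_minus fun_eq_iff prod_eq_iff)
  qed
  moreover have "i_bracket A br \<alpha> (\<lambda>m. scale A (f m) (\<beta> m)) =
      (\<lambda>m. scale A (f m) (i_bracket A br \<alpha> \<beta> m) +
        scale A (ctderiv \<A> m (ctscale \<i> (\<rho> m (\<alpha> m))) f) (\<beta> m))"
    if "\<alpha> \<in> \<Gamma>" "\<beta> \<in> \<Gamma>" "smooth_fun \<A> UNIV f" for \<alpha> \<beta> f
  proof -
    have "ctderiv \<A> m (ctscale \<i> u) f = \<i> * ctderiv \<A> m u f" for m u
      by (simp add: ctderiv_def ctscale_i tderiv_minus[OF that(3)] algebra_simps)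
    then show ?thesis
      by (simp add: ib leibniz[OF that] C.scale_right_distrib mult.commute)
  qed
  moreover have "smooth_fun \<A> (U \<inter> fst c) (\<lambda>m. fst (ctscale \<i> (\<rho> m (inv_into (fiber A m) (\<tau> m) x))) c) \<and>
      smooth_fun \<A> (U \<inter> fst c) (\<lambda>m. snd (ctscale \<i> (\<rho> m (inv_into (fiber A m) (\<tau> m) x))) c)"
    if "(U, \<tau>) \<in> trivs A" "c \<in> \<A>" "x \<in> coord_space (bundle_rank A)" for U \<tau> c x
    using anchor_smooth[OF that] smooth_fun_minus[OF _ anchor_smooth(2)[OF that]]
      open_triv[OF that(1)] open_chart[OF that(2)] by (simp add: ctscale_i open_Int)
  moreover have "ctscale \<i> (\<rho> m a) \<in> ctangent_space \<A> m" if "a \<in> fiber A m" for m a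
    using anchor_tangent[OF scale_fiber[OF that, of \<i>]] by (simp add: anchor_scale that)
  moreover have "ctscale \<i> (\<rho> m (scale A z a)) = ctscale z (ctscale \<i> (\<rho> m a))" if "a \<in> fiber A m" for m a z
    by (simp add: anchor_scale that ctscale_ctscale mult.commute)
  ultimately show ?thesis
    unfolding complex_lie_algebroid_def
    using vector_bundle by (auto simp: anchor_add ctscale_add split: prod.splits)
qed

section \<open>The real part of a complex Lie algebroid\<close>

lemma re_fiber_iff: "a \<in> re_fiber A \<rho> m \<longleftrightarrow> a \<in> fiber A m \<and> snd (\<rho> m a) = 0"
  by (simp add: re_fiber_def anchor2_def)

lemma subspace_re_fiber: "R.subspace (re_fiber A \<rho> m)"
  unfolding R.subspace_def
  by (auto simp: re_fiber_iff anchor_zero C.subspace_0[OF subspace_fiber] add_fiber anchor_add real_scale_def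
      scale_fiber anchor_scale ctscale_of_real tscale_zero)

lemma smooth_functional_anchor2:
  assumes "c \<in> \<A>"
  shows "smooth_functional (fst c) (\<lambda>m a. w \<bullet> snd (\<rho> m a) c)"
  unfolding smooth_functional_def R.functional_on_def
proof (intro conjI ballI allI impI)
  fix m a assume a: "a \<in> fiber A m"
  show "w \<bullet> snd (\<rho> m (a + b)) c = w \<bullet> snd (\<rho> m a) c + w \<bullet> snd (\<rho> m b) c" if "b \<in> fiber A m" for b
    by (simp add: anchor_add[OF a that] inner_add_right)
  show "w \<bullet> snd (\<rho> m (real_scale A r a)) c = r * (w \<bullet> snd (\<rho> m a) c)" for r
    by (simp add: anchor_scale[OF a] real_scale_def ctscale_of_real) (simp add: tscale_def)
next
  fix V s assume V: "open V" "V \<subseteq> fst c" "s \<in> sections \<A> A V"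
  then have "V \<inter> fst c = V" by blast
  with anchor_section_smooth(2)[OF V(1,3) assms]
  have "smooth_fun \<A> V (\<lambda>m. snd (\<rho> m (s m)) c)" by simp
  then show "smooth_fun \<A> V (\<lambda>m. w \<bullet> snd (\<rho> m (s m)) c)"
    by (rule smooth_fun_linear[OF bounded_linear_inner_right V(1)])
qed

text \<open>The functionals are the components of the imaginary part of the anchor in a chart. For a
  vector whose anchor has the imaginary part \<open>w\<close> in the chart, the component along \<open>w\<close> itself is
  nonzero, namely \<open>w \<bullet> w\<close>.\<close>

lemma cut_out_re_fiber: "cut_out (re_fiber A \<rho>)"
  unfolding cut_out_def
proof (intro allI ballI)
  fix p a assume "a \<in> fiber A p - re_fiber A \<rho> p"
  then have a: "a \<in> fiber A p" "snd (\<rho> p a) \<noteq> 0" by (auto simp: re_fiber_iff)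
  obtain c where c: "c \<in> \<A>" "p \<in> fst c" by (rule chart_around)
  define w where "w = snd (\<rho> p a) c"
  have "snd (\<rho> p a) \<in> tangent_space \<A> p"
    using anchor_tangent[OF a(1)] by (auto simp: ctangent_space_def)
  then have "w \<noteq> 0"
    using tangent_space_eq_0 c a(2) unfolding w_def by blast
  show "\<exists>W l. open W \<and> p \<in> W \<and> smooth_functional W l \<and>
      (\<forall>m\<in>W. \<forall>b\<in>re_fiber A \<rho> m. l m b = 0) \<and> l p a \<noteq> 0"
  proof (intro exI conjI)
    show "smooth_functional (fst c) (\<lambda>m b. w \<bullet> snd (\<rho> m b) c)"
      by (rule smooth_functional_anchor2[OF c(1)])
    show "w \<bullet> snd (\<rho> p a) c \<noteq> 0"
      using \<open>w \<noteq> 0\<close> unfolding w_def by simp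
  qed (use c open_chart in \<open>auto simp: re_fiber_iff\<close>)
qed

end

locale constant_real_rank_algebroid = complex_algebroid \<A> A br \<rho>
  for \<A> :: "('m::{t2_space,second_countable_topology}, 'e::real_inner) chart set"
    and A :: "('m, 'v::ab_group_add, complex) vbundle"
    and br :: "('m \<Rightarrow> 'v) \<Rightarrow> ('m \<Rightarrow> 'v) \<Rightarrow> 'm \<Rightarrow> 'v"
    and \<rho> :: "'m \<Rightarrow> 'v \<Rightarrow> ('m, 'e) ctvec" +
  fixes k :: nat
  assumes real_rank: "real_rank A \<rho> m = k"
begin

sublocale re: constant_rank_family \<A> A "re_fiber A \<rho>" k
proof
  show "R.subspace (re_fiber A \<rho> m)" for m by (rule subspace_re_fiber)
  show "re_fiber A \<rho> m \<subseteq> fiber A m" for m by (auto simp: re_fiber_iff)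
  show "cut_out (re_fiber A \<rho>)" by (rule cut_out_re_fiber)
  show "R.dim (re_fiber A \<rho> m) = k" for m using real_rank by (simp add: real_rank_def)
qed

lemma sections_re_bundle:
  "s \<in> sections \<A> (re_bundle \<A> A \<rho> k) UNIV \<longleftrightarrow> s \<in> \<Gamma> \<and> (\<forall>m. snd (\<rho> m (s m)) = 0)"
  unfolding re_bundle_def re.sections_subbundle[OF open_UNIV] re_fiber_iff
  using sections_fiber by auto

text \<open>The imaginary part of the bracket of two complex fields consists of brackets in which one
  argument is the imaginary part of a field.\<close>

lemma anchor_re_bracket:
  assumes "\<alpha> \<in> \<Gamma>" "\<beta> \<in> \<Gamma>" "\<And>m. snd (\<rho> m (\<alpha> m)) = 0" "\<And>m. snd (\<rho> m (\<beta> m)) = 0"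
  shows "\<rho> m (br \<alpha> \<beta> m) = (vf_bracket \<A> (\<lambda>m. fst (\<rho> m (\<alpha> m))) (\<lambda>m. fst (\<rho> m (\<beta> m))) m, 0)"
proof -
  have "\<rho> m (br \<alpha> \<beta> m) = cvf_bracket \<A> (\<lambda>m. \<rho> m (\<alpha> m)) (\<lambda>m. \<rho> m (\<beta> m)) m"
    using anchor_bracket[OF assms(1,2)] by (rule fun_cong)
  also have "\<dots> = (vf_bracket \<A> (\<lambda>m. fst (\<rho> m (\<alpha> m))) (\<lambda>m. fst (\<rho> m (\<beta> m))) m, 0)"
    using vf_bracket_zero[OF anchor_field(1)[OF assms(1)]] vf_bracket_zero[OF anchor_field(1)[OF assms(2)]]
      vf_bracket_zero[of "\<lambda>m. 0"]
    by (simp add: cvf_bracket_def comp_def assms(3,4) smooth_field_def smooth_fun_const)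
  finally show ?thesis .
qed

text \<open>Sections of the real part are sections of \<open>A\<close> whose anchor is real, so all identities for
  the bracket are those of \<open>A\<close>; closure under the bracket and the Leibniz rule use that the
  anchors are real.\<close>

theorem re_algebroid: "real_lie_algebroid \<A> (re_bundle \<A> A \<rho> k) br (anchor_re \<rho>)"
proof -
  let ?E = "re_bundle \<A> A \<rho> k"
  have [simp]: "fiber ?E = re_fiber A \<rho>" "bundle_rank ?E = k" "scale ?E = real_scale A"
    by (simp_all add: re_bundle_def real_subbundle_def)
  have "vector_bundle \<A> ?E"
    unfolding re_bundle_def by (rule re.vector_bundle_subbundle)
  moreover have "lie_bracket_on_sections \<A> ?E br"
    unfolding lie_bracket_on_sections_def Let_def
    by (auto simp: sections_re_bundle anchor_re_bracket real_scale_def bracket_section bracket_add_left bracket_add_right bracket_scale_left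
        bracket_scale_right bracket_self jacobi)
  moreover have "anchor_re \<rho> m a \<in> tangent_space \<A> m \<and>
      (\<forall>b\<in>fiber ?E m. anchor_re \<rho> m (a + b) = anchor_re \<rho> m a + anchor_re \<rho> m b) \<and>
      (\<forall>r. anchor_re \<rho> m (scale ?E r a) = tscale r (anchor_re \<rho> m a))" if "a \<in> fiber ?E m" for m a
    using that anchor_tangent[of a m]
    by (auto simp: re_fiber_iff anchor_re_def anchor1_def anchor_add real_scale_def anchor_scale
        ctscale_of_real ctangent_space_def)
  moreover have "smooth_fun \<A> (U \<inter> fst c) (\<lambda>m. anchor_re \<rho> m (inv_into (fiber ?E m) (\<tau> m) x) c)"
    if "(U, \<tau>) \<in> trivs ?E" "c \<in> \<A>" "x \<in> coord_space (bundle_rank ?E)" for U \<tau> c x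
  proof -
    have U: "(U, \<tau>) \<in> trivs (real_subbundle \<A> A (re_fiber A \<rho>) k)" and x: "x \<in> coord_space k"
      using that by (simp_all add: re_bundle_def re.rank_subbundle)
    have "open U" using U by (simp add: re.trivs_subbundle)
    from anchor_section_smooth(1)[OF this re.subbundle_triv_section[OF U x] that(2)]
    show ?thesis by (simp add: anchor_re_def anchor1_def)
  qed
  moreover have "(\<lambda>m. anchor_re \<rho> m (br \<alpha> \<beta> m)) =
      vf_bracket \<A> (\<lambda>m. anchor_re \<rho> m (\<alpha> m)) (\<lambda>m. anchor_re \<rho> m (\<beta> m))"
    if "\<alpha> \<in> sections \<A> ?E UNIV" "\<beta> \<in> sections \<A> ?E UNIV" for \<alpha> \<beta>
    using that anchor_re_bracket[of \<alpha> \<beta>]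
    by (simp add: sections_re_bundle anchor_re_def anchor1_def)
  moreover have "br \<alpha> (\<lambda>m. scale ?E (f m) (\<beta> m)) =
      (\<lambda>m. scale ?E (f m) (br \<alpha> \<beta> m) + scale ?E (tderiv \<A> m (anchor_re \<rho> m (\<alpha> m)) f) (\<beta> m))"
    if s: "\<alpha> \<in> sections \<A> ?E UNIV" "\<beta> \<in> sections \<A> ?E UNIV" and f: "smooth_fun \<A> UNIV f"
    for \<alpha> \<beta> and f :: "'m \<Rightarrow> real"
  proof -
    have cf: "smooth_fun \<A> UNIV (\<lambda>m. complex_of_real (f m))"
      by (rule smooth_fun_linear[OF bounded_linear_of_real open_UNIV f])
    have "ctderiv \<A> m (\<rho> m (\<alpha> m)) (\<lambda>m. complex_of_real (f m)) =
        of_real (tderiv \<A> m (anchor_re \<rho> m (\<alpha> m)) f)" for m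
      using s(1) by (simp add: sections_re_bundle ctderiv_def tderiv_zero[OF f] anchor_re_def anchor1_def
          tderiv_linear[OF bounded_linear_of_real f])
    with leibniz[OF _ _ cf, of \<alpha> \<beta>] s show ?thesis
      by (simp add: sections_re_bundle real_scale_def)
  qed
  ultimately show ?thesis
    unfolding real_lie_algebroid_def by auto
qed

end

theorem proposition3p5:
  fixes \<A> :: "('m::{t2_space,second_countable_topology}, 'e::real_inner) chart set"
    and A :: "('m, 'v::ab_group_add, complex) vbundle"
    and br :: "('m \<Rightarrow> 'v) \<Rightarrow> ('m \<Rightarrow> 'v) \<Rightarrow> 'm \<Rightarrow> 'v"
    and \<rho> :: "'m \<Rightarrow> 'v \<Rightarrow> ('m, 'e) ctvec"
    and k :: nat
  assumes "smooth_manifold \<A>"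
    and "complex_lie_algebroid \<A> A br \<rho>"
    and "\<And>m. real_rank A \<rho> m = k"
  shows "real_lie_algebroid \<A> (re_bundle \<A> A \<rho> k) br (anchor_re \<rho>) \<and>
    real_lie_algebroid \<A> (i_re_bundle \<A> A \<rho> k) (i_bracket A br) (anchor_im \<rho>) \<and>
    real_lie_algebroid_iso \<A>
      (i_re_bundle \<A> A \<rho> k) (i_bracket A br) (anchor_im \<rho>)
      (re_bundle \<A> A \<rho> k) br (anchor_re \<rho>)
      (mult_i A) \<and>
    (\<forall>m. of_tvec ` anchor_re \<rho> m ` re_fiber A \<rho> m = Delta \<A> A \<rho> m \<and>
         of_tvec ` anchor_im \<rho> m ` mult_i A m ` re_fiber A \<rho> m = Delta \<A> A \<rho> m)"
proof -
  interpret re: constant_real_rank_algebroid \<A> A br \<rho> k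
    using assms by unfold_locales
  let ?\<rho>i = "\<lambda>m a. ctscale \<i> (\<rho> m a)"
  have i_re: "re_fiber A ?\<rho>i m = mult_i A m ` re_fiber A \<rho> m" for m
  proof (intro equalityI subsetI)
    fix a assume "a \<in> re_fiber A ?\<rho>i m"
    then have a: "a \<in> fiber A m" "fst (\<rho> m a) = 0"
      by (simp_all add: re_fiber_def anchor2_def ctscale_i)
    have "snd (\<rho> m (scale A (- \<i>) a)) = 0"
      unfolding re.anchor_scale[OF a(1)] using a(2) by (simp add: ctscale_def tscale_def fun_eq_iff)
    then have "scale A (- \<i>) a \<in> re_fiber A \<rho> m"
      unfolding re.re_fiber_iff using re.scale_fiber[OF a(1)] by blast
    then show "a \<in> mult_i A m ` re_fiber A \<rho> m"
      by (rule rev_image_eqI) (simp add: mult_i_def)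
  next
    fix a assume "a \<in> mult_i A m ` re_fiber A \<rho> m"
    then show "a \<in> re_fiber A ?\<rho>i m"
      by (auto simp: re_fiber_def anchor2_def ctscale_i mult_i_def re.scale_fiber re.anchor_scale)
  qed
  \<comment> \<open>Hence \<open>i_re_bundle\<close> is the real part of the algebroid multiplied by \<open>\<i>\<close>.\<close>
  interpret im: constant_real_rank_algebroid \<A> A "i_bracket A br" ?\<rho>i k
  proof unfold_locales
    show "complex_lie_algebroid \<A> A (i_bracket A br) ?\<rho>i" by (rule re.multiply_i)
    show "real_rank A ?\<rho>i m = k" for m
      using re.dim_scale_image[OF re.subspace_re_fiber, of \<i> m] assms(3)[of m]
      unfolding real_rank_def i_re mult_i_def by simp
  qed
  have im_bundle: "re_bundle \<A> A ?\<rho>i k = i_re_bundle \<A> A \<rho> k"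
    by (simp add: re_bundle_def i_re_bundle_def i_re[abs_def])
  have im_anchor: "anchor_re ?\<rho>i = anchor_im \<rho>"
    by (simp add: fun_eq_iff anchor_re_def anchor1_def anchor_im_def anchor2_def ctscale_i)
  have im_algebroid: "real_lie_algebroid \<A> (i_re_bundle \<A> A \<rho> k) (i_bracket A br) (anchor_im \<rho>)"
    using im.re_algebroid unfolding im_bundle im_anchor .

  have maps: "scale A \<i> a \<in> re_fiber A \<rho> m" if "a \<in> re_fiber A ?\<rho>i m" for a m
    using that by (auto simp: re_fiber_def anchor2_def ctscale_i re.scale_fiber re.anchor_scale)
  have maps': "scale A (- \<i>) b \<in> re_fiber A ?\<rho>i m" if "b \<in> re_fiber A \<rho> m" for b m
  proof -
    have b: "b \<in> fiber A m" "snd (\<rho> m b) = 0" using that by (simp_all add: re.re_fiber_iff)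
    have "fst (\<rho> m (scale A (- \<i>) b)) = 0"
      unfolding re.anchor_scale[OF b(1)] using b(2) by (simp add: ctscale_def tscale_def fun_eq_iff)
    with re.scale_fiber[OF b(1)] show ?thesis
      by (simp add: re_fiber_def anchor2_def ctscale_i del: re.C.scale_minus_left)
  qed
  have bij: "bij_betw (mult_i A m) (re_fiber A ?\<rho>i m) (re_fiber A \<rho> m)" for m
    by (rule bij_betwI[where g = "scale A (- \<i>)"]) (use maps maps' in \<open>auto simp: mult_i_def\<close>)
  have inv: "inv_into (re_fiber A ?\<rho>i m) (mult_i A m) b = scale A (- \<i>) b" if "b \<in> re_fiber A \<rho> m" for b m
    by (rule inv_into_f_eq) (use bij maps'[OF that] in \<open>auto simp: bij_betw_def mult_i_def\<close>)
  have "bundle_iso \<A> (i_re_bundle \<A> A \<rho> k) (re_bundle \<A> A \<rho> k) (mult_i A)"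
    unfolding bundle_iso_def im_bundle[symmetric] unfolding re_bundle_def re.re.fiber_subbundle im.re.fiber_subbundle
  proof (intro conjI allI bij)
    show "bundle_map \<A> (real_subbundle \<A> A (re_fiber A ?\<rho>i) k) (real_subbundle \<A> A (re_fiber A \<rho>) k) (mult_i A)"
      by (rule bundle_map_scale[OF im.re.constant_rank_family_axioms re.re.constant_rank_family_axioms])
        (auto simp: mult_i_def maps)
    show "bundle_map \<A> (real_subbundle \<A> A (re_fiber A \<rho>) k) (real_subbundle \<A> A (re_fiber A ?\<rho>i) k)
        (\<lambda>m. inv_into (re_fiber A ?\<rho>i m) (mult_i A m))"
      by (rule bundle_map_scale[OF re.re.constant_rank_family_axioms im.re.constant_rank_family_axioms])
        (auto simp: inv maps' simp del: re.C.scale_minus_left)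
  qed
  moreover have "(\<lambda>m. mult_i A m (i_bracket A br \<alpha> \<beta> m)) = br (\<lambda>m. mult_i A m (\<alpha> m)) (\<lambda>m. mult_i A m (\<beta> m))"
    if "\<alpha> \<in> sections \<A> (i_re_bundle \<A> A \<rho> k) UNIV" "\<beta> \<in> sections \<A> (i_re_bundle \<A> A \<rho> k) UNIV" for \<alpha> \<beta>
  proof -
    have s: "\<alpha> \<in> re.\<Gamma>" "\<beta> \<in> re.\<Gamma>"
      using that unfolding im_bundle[symmetric] im.sections_re_bundle by auto
    have "(\<lambda>m. scale A \<i> (\<beta> m)) \<in> re.\<Gamma>"
      by (intro re.sections_scale re.smooth_fun_const s open_UNIV)
    from re.bracket_scale_left[OF s(1) this, of \<i>] show ?thesis
      by (simp add: mult_i_def i_bracket_def re.bracket_scale_right[OF s])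
  qed
  moreover have "anchor_re \<rho> m (mult_i A m a) = anchor_im \<rho> m a" if "a \<in> fiber (i_re_bundle \<A> A \<rho> k) m" for m a
  proof -
    have "a \<in> fiber A m"
      using that unfolding im_bundle[symmetric] re_bundle_def im.re.fiber_subbundle im.re_fiber_iff by blast
    then show ?thesis
      by (simp add: anchor_re_def anchor1_def anchor_im_def anchor2_def mult_i_def re.anchor_scale ctscale_i)
  qed
  ultimately have iso: "real_lie_algebroid_iso \<A> (i_re_bundle \<A> A \<rho> k) (i_bracket A br) (anchor_im \<rho>)
      (re_bundle \<A> A \<rho> k) br (anchor_re \<rho>) (mult_i A)"
    by (simp add: real_lie_algebroid_iso_def)

  have Delta: "of_tvec ` anchor_re \<rho> m ` re_fiber A \<rho> m = Delta \<A> A \<rho> m" for m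
  proof (intro equalityI subsetI)
    fix u assume "u \<in> of_tvec ` anchor_re \<rho> m ` re_fiber A \<rho> m"
    then obtain a where a: "a \<in> fiber A m" "snd (\<rho> m a) = 0" "u = (fst (\<rho> m a), 0)"
      by (auto simp: re.re_fiber_iff anchor_re_def anchor1_def of_tvec_def)
    then have u: "u = \<rho> m a" "u = conj_ctvec (\<rho> m a)" "u = of_tvec (fst (\<rho> m a))"
      by (auto simp: prod_eq_iff conj_ctvec_def of_tvec_def)
    have "fst (\<rho> m a) \<in> tangent_space \<A> m"
      using re.anchor_tangent[OF a(1)] by (auto simp: ctangent_space_def)
    with u a(1) show "u \<in> Delta \<A> A \<rho> m"
      unfolding Delta_def by blast
  next
    fix u assume "u \<in> Delta \<A> A \<rho> m"
    then obtain a v where a: "a \<in> fiber A m" "u = \<rho> m a" "u = of_tvec v"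
      unfolding Delta_def by blast
    then have "\<rho> m a = (v, 0)" by (simp add: of_tvec_def)
    with a have "a \<in> re_fiber A \<rho> m" "u = of_tvec (anchor_re \<rho> m a)"
      by (simp_all add: re.re_fiber_iff anchor_re_def anchor1_def of_tvec_def)
    then show "u \<in> of_tvec ` anchor_re \<rho> m ` re_fiber A \<rho> m" by blast
  qed
  \<comment> \<open>The anchor of \<open>i_re_bundle\<close> takes on \<open>\<i> a\<close> the value of \<open>anchor_re\<close> on \<open>- a\<close>.\<close>
  have "anchor_im \<rho> m ` mult_i A m ` re_fiber A \<rho> m = anchor_re \<rho> m ` re_fiber A \<rho> m" for m
  proof -
    have "anchor_im \<rho> m ` mult_i A m ` re_fiber A \<rho> m = anchor_re \<rho> m ` uminus ` re_fiber A \<rho> m"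
      unfolding image_image
    proof (rule image_cong[OF refl])
      fix a assume "a \<in> re_fiber A \<rho> m"
      then show "anchor_im \<rho> m (mult_i A m a) = anchor_re \<rho> m (- a)"
        using re.anchor_scale[of a m "- 1"]
        by (simp add: re.re_fiber_iff anchor_re_def anchor1_def anchor_im_def anchor2_def mult_i_def
            re.anchor_scale ctscale_i) (simp add: ctscale_def tscale_def fun_eq_iff)
    qed
    also have "uminus ` re_fiber A \<rho> m = re_fiber A \<rho> m"
      using re.R.subspace_neg[OF re.subspace_re_fiber] by force
    finally show ?thesis .
  qed
  with Delta show ?thesis
    using re.re_algebroid im_algebroid iso by simp
qed

end
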